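(* Let $I,J\ge1$ be integers, $q>0$ real with $q\neq1$, $\nu=q^{-I}$, and $\alpha$ real such that all denominators below are nonzero. For all fixed $v,v'\in\{0,\dots,I\}$ and $h,h'\in\{0,\dots,J\}$, $$\sum_{\substack{(h_1,\dots,h_J)\in\{0,1\}^J\\(h_1',\dots,h_J')\in\{0,1\}^J}}\Lambda\big(h;(h_1,\dots,h_J)\big)\,L_\alpha^{\otimes_qJ}(v,h_1,\dots,h_J;v',h_1',\dots,h_J')\,\Xi\big((h_1',\dots,h_J');h'\big)$$ $$=\sum_{\substack{(h_1,\dots,h_J)\in\{0,1\}^J\\(h_1',\dots,h_J')\in\{0,1\}^J}}\widetilde\Lambda\big(h;(h_1,\dots,h_J)\big)\,\widetilde L_\alpha^{\otimes_qJ}(v,h_1,\dots,h_J;v',h_1',\dots,h_J')\,\Xi\big((h_1',\dots,h_J');h'\big).$$ Consequently, $$L^{(J)}_\alpha(v,h;v',h')=\sum_{\substack{(h_1,\dots,h_J)\in\{0,1\}^J\\(h_1',\dots,h_J')\in\{0,1\}^J}}\widetilde\Lambda\big(h;(h_1,\dots,h_J)\big)\,\widetilde L_\alpha^{\otimes_qJ}(v,h_1,\dots,h_J;v',h_1',\dots,h_J')\,\Xi\big((h_1',\dots,h_J');h'\big).$$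
   Context: $q$-Pochhammer symbols: $(a;q)_n=\prod_{k=0}^{n-1}(1-aq^k)$ for $n\ge0$ and $(a;q)_n=\prod_{k=1}^{-n}(1-aq^{-k})^{-1}$ for $n<0$. $J=1$ weights: on $\{0,\dots,I\}\times\{0,1\}$, with $\nu=q^{-I}$, $$L^{(1)}_\alpha(m,0;m,0)=\frac{1+\alpha q^m}{1+\alpha},\quad L^{(1)}_\alpha(m,0;m-1,1)=\frac{\alpha(1-q^m)}{1+\alpha},\quad L^{(1)}_\alpha(m,1;m,1)=\frac{\alpha+\nu q^m}{1+\alpha},\quad L^{(1)}_\alpha(m,1;m+1,0)=\frac{1-\nu q^m}{1+\alpha},$$ and all other entries are $0$. Column weights (sums over $v_0,\dots,v_J\in\{0,\dots,I\}$ with $v_0=v$, $v_J=v'$): $$L_\alpha^{\otimes_qJ}(v,h_1,\dots,h_J;v',h_1',\dots,h_J')=\sum_{v_0,\dots,v_J}\prod_{i=1}^JL^{(1)}_{\alpha q^{i-1}}(v_{i-1},h_i;v_i,h_i'),$$ $$\widetilde L_\alpha^{\otimes_qJ}(v,h_1,\dots,h_J;v',h_1',\dots,h_J')=\sum_{v_0,\dots,v_J}\prod_{i=1}^JL^{(1)}_{\alpha q^{J-i}}(v_{i-1},h_i;v_i,h_i').$$ With $Z_J(h)=q^{h(h-1)/2}\frac{(q;q)_J}{(q;q)_h(q;q)_{J-h}}$: $\Lambda(h;(h_1,\dots,h_J))=\frac1{Z_J(h)}\prod_{i:h_i=1}q^{i-1}$ and $\widetilde\Lambda(h;(h_1,\dots,h_J))=\frac1{Z_J(h)}\prod_{i:h_i=1}q^{J-i}$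 if $h=\sum_{i=1}^Jh_i$, and both are $0$ otherwise. $\Xi((h_1,\dots,h_J);h)=1$ if $h=\sum_{i=1}^Jh_i$ and $0$ otherwise. General $J$ weights, on $\{0,\dots,I\}\times\{0,\dots,J\}$: $$L^{(J)}_\alpha(i_1,j_1;i_2,j_2)=\mathbf 1_{\{i_1+j_1=i_2+j_2\}}\,q^{\frac{2j_1-j_1^2}{4}-\frac{2j_2-j_2^2}{4}+\frac{i_2^2+i_1^2}{4}+\frac{i_2(j_2-1)+i_1j_1}{2}}\,\frac{\nu^{j_1-i_2}\alpha^{j_2-j_1+i_2}(-\alpha\nu^{-1};q)_{j_2-i_1}}{(q;q)_{i_2}(-\alpha;q)_{i_2+j_2}(q^{J+1-j_1};q)_{j_1-j_2}}\;{}_4\bar\phi_3\Big(\begin{matrix}q^{-i_2};q^{-i_1},-\alpha q^J,-q\nu\alpha^{-1}\\ \nu,\,q^{1+j_2-i_1},\,q^{J+1-i_2-j_2}\end{matrix}\Big|q,q\Big),$$ where $${}_{r+1}\bar\phi_r\Big(\begin{matrix}q^{-n};a_1,\dots,a_r\\ b_1,\dots,b_r\end{matrix}\Big|q,z\Big)=\sum_{k=0}^n z^k\frac{(q^{-n};q)_k}{(q;q)_k}\prod_{i=1}^r(a_i;q)_k(b_iq^k;q)_{n-k}.$$ The denominators are those occurring in these formulas (in particular $\alpha\ne0$ and $1+\alpha q^i\neq0$ for the relevant $i$). *)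

theory Defs
  imports Complex_Main "HOL-Library.FuncSet"
begin

definition qpoch :: "real \<Rightarrow> real \<Rightarrow> int \<Rightarrow> real" where
  "qpoch a q n =
     (if n \<ge> 0 then \<Prod>k<nat n. 1 - a * q ^ k
      else \<Prod>k=1..nat (- n). inverse (1 - a * q powi (- int k)))"

text \<open>The lists \<open>as\<close> and \<open>bs\<close> hold the \<open>r\<close> upper and the \<open>r\<close> lower parameters; the
  remaining upper parameter \<open>q\<^sup>-\<^sup>n\<close> enters through \<open>n\<close>.\<close>

definition phi_bar :: "nat \<Rightarrow> real list \<Rightarrow> real list \<Rightarrow> real \<Rightarrow> real \<Rightarrow> real" where
  "phi_bar n as bs q z =
     (\<Sum>k=0..n. z ^ k * (qpoch (q powi (- int n)) q (int k) / qpoch q q (int k))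
        * (\<Prod>a\<leftarrow>as. qpoch a q (int k))
        * (\<Prod>b\<leftarrow>bs. qpoch (b * q ^ k) q (int n - int k)))"

definition L1 :: "real \<Rightarrow> real \<Rightarrow> real \<Rightarrow> nat \<Rightarrow> nat \<Rightarrow> nat \<Rightarrow> nat \<Rightarrow> real" where
  "L1 q \<nu> \<alpha> m j m' j' =
     (if j = 0 \<and> j' = 0 \<and> m' = m then (1 + \<alpha> * q ^ m) / (1 + \<alpha>)
      else if j = 0 \<and> j' = 1 \<and> m = m' + 1 then \<alpha> * (1 - q ^ m) / (1 + \<alpha>)
      else if j = 1 \<and> j' = 1 \<and> m' = m then (\<alpha> + \<nu> * q ^ m) / (1 + \<alpha>)
      else if j = 1 \<and> j' = 0 \<and> m' = m + 1 then (1 - \<nu> * q ^ m) / (1 + \<alpha>)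
      else 0)"

text \<open>Tuples \<open>(h\<^sub>1, \<dots>, h\<^sub>J)\<close> and \<open>(v\<^sub>0, \<dots>, v\<^sub>J)\<close> are extensional functions on
  \<open>{1..J}\<close> and \<open>{0..J}\<close>, so that each tuple is counted exactly once in a sum.\<close>

definition bits :: "nat \<Rightarrow> (nat \<Rightarrow> nat) set" where
  "bits J = {1..J} \<rightarrow>\<^sub>E {0, 1}"

definition vpaths :: "nat \<Rightarrow> nat \<Rightarrow> nat \<Rightarrow> nat \<Rightarrow> (nat \<Rightarrow> nat) set" where
  "vpaths I J v v' = {w \<in> {0..J} \<rightarrow>\<^sub>E {0..I}. w 0 = v \<and> w J = v'}"

definition Lcol ::
  "real \<Rightarrow> real \<Rightarrow> nat \<Rightarrow> nat \<Rightarrow> real \<Rightarrow> nat \<Rightarrow> (nat \<Rightarrow> nat) \<Rightarrow> nat \<Rightarrow> (nat \<Rightarrow> nat) \<Rightarrow> real" where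
  "Lcol q \<nu> I J \<alpha> v hs v' hs' =
     (\<Sum>w\<in>vpaths I J v v'. \<Prod>i=1..J. L1 q \<nu> (\<alpha> * q ^ (i - 1)) (w (i - 1)) (hs i) (w i) (hs' i))"

definition Lcol_tilde ::
  "real \<Rightarrow> real \<Rightarrow> nat \<Rightarrow> nat \<Rightarrow> real \<Rightarrow> nat \<Rightarrow> (nat \<Rightarrow> nat) \<Rightarrow> nat \<Rightarrow> (nat \<Rightarrow> nat) \<Rightarrow> real" where
  "Lcol_tilde q \<nu> I J \<alpha> v hs v' hs' =
     (\<Sum>w\<in>vpaths I J v v'. \<Prod>i=1..J. L1 q \<nu> (\<alpha> * q ^ (J - i)) (w (i - 1)) (hs i) (w i) (hs' i))"

definition Z :: "real \<Rightarrow> nat \<Rightarrow> nat \<Rightarrow> real" where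
  "Z q J h = q ^ (h * (h - 1) div 2)
     * (qpoch q q (int J) / (qpoch q q (int h) * qpoch q q (int J - int h)))"

definition Lambda :: "real \<Rightarrow> nat \<Rightarrow> nat \<Rightarrow> (nat \<Rightarrow> nat) \<Rightarrow> real" where
  "Lambda q J h hs =
     (if h = (\<Sum>i=1..J. hs i) then 1 / Z q J h * (\<Prod>i\<in>{i \<in> {1..J}. hs i = 1}. q ^ (i - 1)) else 0)"

definition Lambda_tilde :: "real \<Rightarrow> nat \<Rightarrow> nat \<Rightarrow> (nat \<Rightarrow> nat) \<Rightarrow> real" where
  "Lambda_tilde q J h hs =
     (if h = (\<Sum>i=1..J. hs i) then 1 / Z q J h * (\<Prod>i\<in>{i \<in> {1..J}. hs i = 1}. q ^ (J - i)) else 0)"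

definition Xi :: "nat \<Rightarrow> (nat \<Rightarrow> nat) \<Rightarrow> nat \<Rightarrow> real" where
  "Xi J hs h = (if h = (\<Sum>i=1..J. hs i) then 1 else 0)"

text \<open>The leading exponent of \<open>q\<close> is in general a multiple of 1/4 only, hence \<open>powr\<close>, which is
  the usual real power for \<open>q > 0\<close>; all other powers have integer exponents, so their bases may be negative.\<close>

definition LJ ::
  "real \<Rightarrow> real \<Rightarrow> nat \<Rightarrow> real \<Rightarrow> nat \<Rightarrow> nat \<Rightarrow> nat \<Rightarrow> nat \<Rightarrow> real" where
  "LJ q \<nu> J \<alpha> i1 j1 i2 j2 =
     (if i1 + j1 = i2 + j2 then
        q powr ((2 * real j1 - (real j1)\<^sup>2) / 4 - (2 * real j2 - (real j2)\<^sup>2) / 4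
                + ((real i2)\<^sup>2 + (real i1)\<^sup>2) / 4
                + (real i2 * (real j2 - 1) + real i1 * real j1) / 2)
        * (\<nu> powi (int j1 - int i2) * \<alpha> powi (int j2 - int j1 + int i2)
             * qpoch (- \<alpha> * inverse \<nu>) q (int j2 - int i1)
           / (qpoch q q (int i2) * qpoch (- \<alpha>) q (int i2 + int j2)
              * qpoch (q powi (int J + 1 - int j1)) q (int j1 - int j2)))
        * phi_bar i2
            [q powi (- int i1), - \<alpha> * q ^ J, - q * \<nu> * inverse \<alpha>]
            [\<nu>, q powi (1 + int j2 - int i1), q powi (int J + 1 - int i2 - int j2)]
            q q
      else 0)"

end

theory Submission
  imports Defs
begin

text \<open>After clearing denominators, the row with spectral parameter \<open>\<alpha> t\<close>, weighted by \<open>t\<close> for an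
  entering path, acts as \<open>1 + t N + t\<^sup>2 P\<close>, where \<open>N\<close> does not depend on \<open>t\<close> and \<open>P\<close> commutes with \<open>N\<close>.
  Hence rows with different \<open>t\<close> commute, and the product over \<open>t = 1, q, \<dots>, q\<^sup>J\<^sup>-\<^sup>1\<close> may be taken in
  increasing or in decreasing order, which is the equality of the two sums. Up to normalisation, the
  summand of the hypergeometric series is the total weight of the configurations with a given number
  of down, up and horizontal rows, brought into the order down, horizontal, up. Appending one more row
  with \<open>t = q\<^sup>J\<close> and restoring this order gives a recursion in \<open>J\<close> that holds summand by summand
  once the weight of a down step is split suitably.\<close>

section \<open>The normally ordered terms and their recursion\<close>

definition qprod :: "real \<Rightarrow> real \<Rightarrow> nat \<Rightarrow> real" where
  "qprod a q n = (\<Prod>i<n. 1 - a * q ^ i)"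

lemma qprod_0 [simp]: "qprod a q 0 = 1"
  by (simp add: qprod_def)

lemma qprod_Suc: "qprod a q (Suc n) = qprod a q n * (1 - a * q ^ n)"
  by (simp add: qprod_def)

lemma qprod_Suc_shift: "qprod a q (Suc n) = (1 - a) * qprod (a * q) q n"
  unfolding qprod_def by (simp only: prod.lessThan_Suc_shift) (simp add: mult.assoc)

lemma qprod_add: "qprod a q (m + n) = qprod a q m * qprod (a * q ^ m) q n"
  by (induction n) (simp_all add: qprod_Suc power_add mult.assoc)

lemma qpoch_int: "qpoch a q (int n) = qprod a q n"
  by (simp add: qpoch_def qprod_def)

text \<open>For nonzero \<alpha> this is \<alpha>^n times the q-Pochhammer symbol of -a/\<alpha> in
  base 1/q. Written without division by \<alpha>, it is the form in which the weights
  \<open>\<alpha> * t + \<nu> * q ^ m\<close> of occupied horizontal rows accumulate.\<close>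

definition lprod :: "real \<Rightarrow> real \<Rightarrow> real \<Rightarrow> nat \<Rightarrow> real" where
  "lprod \<alpha> a q n = (\<Prod>i<n. \<alpha> + a / q ^ i)"

lemma lprod_0 [simp]: "lprod \<alpha> a q 0 = 1"
  by (simp add: lprod_def)

lemma lprod_Suc: "lprod \<alpha> a q (Suc n) = lprod \<alpha> a q n * (\<alpha> + a / q ^ n)"
  by (simp add: lprod_def)

lemma lprod_Suc_shift: "q \<noteq> 0 \<Longrightarrow> lprod \<alpha> (a * q) q (Suc n) = (\<alpha> + a * q) * lprod \<alpha> a q n"
  unfolding lprod_def by (simp only: prod.lessThan_Suc_shift) simp

lemma choose2_Suc: "(Suc n choose 2) = n + (n choose 2)"
  by (simp add: numeral_2_eq_2)

text \<open>A q-multinomial coefficient times a power of q, but without its numerator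
  \<open>qprod q q (l + d + e + f)\<close>. That numerator depends only on the number of rows and is
  kept in \<open>core_term\<close>, so that changing one index alters \<open>qmult\<close> by a
  short factor.\<close>

definition qmult :: "real \<Rightarrow> nat \<Rightarrow> nat \<Rightarrow> nat \<Rightarrow> nat \<Rightarrow> real" where
  "qmult q l d e f = q ^ (((l + d + e) choose 2) + (e choose 2))
     / (qprod q q l * qprod q q d * qprod q q e * qprod q q f)"

text \<open>All of \<open>fused_term\<close> except the product over the up steps, which is the
  product that both shares of a down step alter.\<close>

definition core_term :: "real \<Rightarrow> real \<Rightarrow> real \<Rightarrow> nat \<Rightarrow> nat \<Rightarrow> nat \<Rightarrow> nat \<Rightarrow> nat \<Rightarrow> real" where
  "core_term q \<nu> \<alpha> l d e f k = qprod q q (l + d + e + f) * qmult q l d e f * \<alpha> ^ d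
     * qprod (q ^ Suc k) q d * qprod (- \<alpha> * q ^ (k + l + d + e)) q f
     * lprod \<alpha> (\<nu> * q ^ k) q e"

text \<open>Total weight of the fused paths with \<open>d\<close> down, \<open>l\<close> up, \<open>e\<close> occupied and \<open>f\<close> empty
  horizontal rows, normally ordered: from height \<open>k + d\<close> first down to the lowest height \<open>k\<close>, then the
  horizontal rows, then up to \<open>k + l\<close>. It is the summand of \<open>phi_bar\<close> with index \<open>k\<close>.\<close>

definition fused_term :: "real \<Rightarrow> real \<Rightarrow> real \<Rightarrow> nat \<Rightarrow> nat \<Rightarrow> nat \<Rightarrow> nat \<Rightarrow> nat \<Rightarrow> real" where
  "fused_term q \<nu> \<alpha> l d e f k = core_term q \<nu> \<alpha> l d e f k * qprod (\<nu> * q ^ k) q l"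

text \<open>A down step after the \<open>l\<close> up steps has weight proportional to \<open>1 - q ^ (k + l)\<close>. To restore the
  normal order it is split into a part that becomes a further down step and a part that cancels one
  up step. The shares are \<open>q ^ l * (1 - q ^ k) * (1 - \<nu> * q ^ (k - 1)) / (1 - \<nu> * q ^ (k + l - 1))\<close> and
  \<open>(1 - q ^ l) * (1 - \<nu> * q ^ (2 * k + l - 1)) / (1 - \<nu> * q ^ (k + l - 1))\<close>; the denominator, which may
  vanish, is cancelled against the last factor of the product over the up steps.\<close>

definition split_a :: "real \<Rightarrow> real \<Rightarrow> real \<Rightarrow> nat \<Rightarrow> nat \<Rightarrow> nat \<Rightarrow> nat \<Rightarrow> nat \<Rightarrow> real" where
  "split_a q \<nu> \<alpha> l d e f k = q ^ l * (1 - q ^ k)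
     * qprod (\<nu> * q ^ k / q) q l * core_term q \<nu> \<alpha> l d e f k"

definition split_b :: "real \<Rightarrow> real \<Rightarrow> real \<Rightarrow> nat \<Rightarrow> nat \<Rightarrow> nat \<Rightarrow> nat \<Rightarrow> nat \<Rightarrow> real" where
  "split_b q \<nu> \<alpha> l d e f k = (1 - q ^ l) * (1 - \<nu> * (q ^ k * q ^ k) * q ^ l / q)
     * qprod (\<nu> * q ^ k) q (l - 1) * core_term q \<nu> \<alpha> l d e f k"

lemma split_a_plus_split_b:
  assumes "q \<noteq> 0"
  shows "split_a q \<nu> \<alpha> l d e f k + split_b q \<nu> \<alpha> l d e f k
    = (1 - q ^ (k + l)) * fused_term q \<nu> \<alpha> l d e f k"
proof (cases l)
  case 0
  then show ?thesis by (simp add: split_a_def split_b_def fused_term_def)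
next
  case (Suc l')
  have "qprod (\<nu> * q ^ k / q) q l = (1 - \<nu> * q ^ k / q) * qprod (\<nu> * q ^ k) q l'"
    unfolding Suc qprod_Suc_shift using assms by simp
  moreover have "qprod (\<nu> * q ^ k) q l = (1 - \<nu> * q ^ (k + l')) * qprod (\<nu> * q ^ k) q l'"
    unfolding Suc qprod_Suc by (simp add: power_add mult.assoc)
  \<comment> \<open>After removal of the common product over the first \<open>l'\<close> up steps,
    the numerators of the two shares satisfy this polynomial identity.\<close>
  moreover have "q ^ l * (1 - q ^ k) * (1 - \<nu> * q ^ k / q) + (1 - q ^ l) * (1 - \<nu> * (q ^ k * q ^ k) * q ^ l / q)
      = (1 - q ^ (k + l)) * (1 - \<nu> * q ^ (k + l'))"
    using assms by (simp add: Suc power_add field_simps)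
  ultimately have "q ^ l * (1 - q ^ k) * qprod (\<nu> * q ^ k / q) q l
      + (1 - q ^ l) * (1 - \<nu> * (q ^ k * q ^ k) * q ^ l / q) * qprod (\<nu> * q ^ k) q (l - 1)
      = (1 - q ^ (k + l)) * qprod (\<nu> * q ^ k) q l"
    using Suc by (simp only: diff_Suc_1 mult.assoc[symmetric] distrib_right[symmetric])
  then show ?thesis
    unfolding split_a_def split_b_def fused_term_def
    by (simp only: distrib_right[symmetric] mult.assoc[symmetric]) (simp add: mult_ac)
qed

section \<open>Ratios of the multiplicities\<close>

context
  fixes q :: real
  assumes q: "q > 0" "q \<noteq> 1"
begin

lemma one_minus_power_nonzero: "1 - q * q ^ n \<noteq> 0"
  using q power_eq_1_iff[of q "Suc n"] by auto

lemma qprod_q_nonzero: "qprod q q n \<noteq> 0"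
  using one_minus_power_nonzero by (auto simp: qprod_def)

text \<open>The index \<open>f\<close> does not enter the exponent of q. In the next three ratios
  \<open>q ^ (l + d + e)\<close> is the increment of the first binomial coefficient, and the extra
  \<open>q ^ e\<close> in \<open>qmult_e\<close> that of the second.\<close>

lemma qmult_f: "qmult q l d e f = qmult q l d e (Suc f) * (1 - q * q ^ f)"
  using qprod_q_nonzero one_minus_power_nonzero by (simp add: qmult_def qprod_Suc field_simps)

lemma qmult_e: "q ^ (l + d + e) * q ^ e * qmult q l d e f = qmult q l d (Suc e) f * (1 - q * q ^ e)"
  using qprod_q_nonzero one_minus_power_nonzero
  by (simp add: qmult_def qprod_Suc choose2_Suc power_add field_simps)

lemma qmult_l: "q ^ (l + d + e) * qmult q l d e f = qmult q (Suc l) d e f * (1 - q * q ^ l)"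
  using qprod_q_nonzero one_minus_power_nonzero
  by (simp add: qmult_def qprod_Suc choose2_Suc power_add field_simps)

lemma qmult_d: "q ^ (l + d + e) * qmult q l d e f = qmult q l (Suc d) e f * (1 - q * q ^ d)"
  using qprod_q_nonzero one_minus_power_nonzero
  by (simp add: qmult_def qprod_Suc choose2_Suc power_add field_simps)

text \<open>Serves the share of a down step that cancels an up step: the two rows involved are then
  counted as one occupied and one empty horizontal row.\<close>

lemma qmult_lef:
  "(1 - q * q ^ l) * q ^ e * qmult q (Suc l) d e f
     = qmult q l d (Suc e) (Suc f) * (1 - q * q ^ e) * (1 - q * q ^ f)"
proof -
  have "(1 - q * q ^ l) * q ^ e * qmult q (Suc l) d e f = q ^ (l + d + e) * q ^ e * qmult q l d e f"
    using qmult_l[of l d e f] by simp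
  also have "\<dots> = qmult q l d (Suc e) f * (1 - q * q ^ e)" by (rule qmult_e)
  finally show ?thesis using qmult_f[of l d "Suc e" f] by simp
qed

end

text \<open>The recursion for one summand, stripped of common factors, with x, y, K, N standing for
  q to the powers l, d, k, n and z, w for q to the powers e - 1, f - 1. The five terms on the right
  belong to an empty row, an occupied row, an up step and the two shares of a down step. The next
  two identities are the cases e = 0 and f = 0, where some of these terms are absent.\<close>

lemma recursion_identity:
  fixes x y z w K q \<alpha> \<nu> :: real
  assumes "z \<noteq> 0" and N: "N = q * x * y * z * w"
  shows "(1 - q * N) * (1 + \<alpha> * N * K) * (\<alpha> + \<nu> * K / z) =
    (1 - q * w) * (1 + \<alpha> * N * K * x) * (\<alpha> + \<nu> * K / z)
    + q * w / z * (1 - q * z) * (\<alpha> * N + \<nu> * K * x) * (1 + \<alpha> * x * y * z * K)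
    + q * w * (1 - x) * (\<alpha> + \<nu> * K / z) * (1 + \<alpha> * x * y * z * K)
    + q * w * x * (1 - y) * (\<alpha> + \<nu> * K * q) * (1 + \<alpha> * N * K)
    + N / z * (1 - q * z) * (1 - q * w) * \<alpha> * (1 - \<nu> * K * K * x)"
  unfolding N using assms(1) by (simp add: field_simps)

lemma recursion_identity_e0:
  fixes x y w K q \<alpha> :: real
  assumes "q \<noteq> 0" and N: "N = x * y * w"
  shows "(1 - q * N) * (1 + \<alpha> * N * K) =
    (1 - q * w) * (1 + \<alpha> * N * K * x)
    + q * w * (1 - x) * (1 + \<alpha> * (x * y / q) * K)
    + q * w * x * (1 - y) * (1 + \<alpha> * N * K)"
  unfolding N using assms(1) by (simp add: field_simps)

lemma recursion_identity_f0:
  fixes x y z K q \<alpha> \<nu> :: real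
  assumes "z \<noteq> 0" and N: "N = x * y * z"
  shows "(1 - q * N) * (\<alpha> + \<nu> * K / z) =
     1 / z * (1 - q * z) * (\<alpha> * N + \<nu> * K * x)
    + (1 - x) * (\<alpha> + \<nu> * K / z)
    + x * (1 - y) * (\<alpha> + \<nu> * K * q)"
  unfolding N using assms(1) by (simp add: field_simps)

text \<open>A last row with t = \<open>q ^ n\<close> is appended to configurations of
  \<open>n\<close> rows. An empty row, an occupied row or an up step is already in normal order up
  to reordering with horizontal rows. A down step contributes through its shares:
  \<open>split_a\<close> moves it to the front, so the lowest height drops from \<open>k + 1\<close>
  to \<open>k\<close>; \<open>split_b\<close> removes one of \<open>l + 1\<close> up steps.\<close>

lemma fused_term_recursion:
  fixes q :: real
  assumes q: "q > 0" "q \<noteq> 1" and n: "l + d + e + f = Suc n"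
  shows "fused_term q \<nu> \<alpha> l d e f k =
     (if f = 0 then 0 else fused_term q \<nu> \<alpha> l d e (f - 1) k * (1 + \<alpha> * q ^ n * q ^ (k + l)))
   + (if e = 0 then 0 else fused_term q \<nu> \<alpha> l d (e - 1) f k * (q ^ n * (\<alpha> * q ^ n + \<nu> * q ^ (k + l))))
   + (if l = 0 then 0 else fused_term q \<nu> \<alpha> (l - 1) d e f k * (q ^ n * (1 - \<nu> * q ^ (k + l - 1))))
   + (if d = 0 then 0 else \<alpha> * q ^ n * split_a q \<nu> \<alpha> l (d - 1) e f (k + 1))
   + (if e = 0 \<or> f = 0 then 0 else \<alpha> * q ^ n * split_b q \<nu> \<alpha> (l + 1) d (e - 1) (f - 1) k)"
   (is "?T = ?F + ?E + ?L + ?A + ?B")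
proof -
  define s where "s = l + d + e"
  \<comment> \<open>The factor common to all six terms; each is next written as \<open>G\<close>
    times its remaining factors.\<close>
  define G where "G = qprod q q n * qmult q l d e f * \<alpha> ^ d * qprod (q ^ Suc k) q d * qprod (\<nu> * q ^ k) q l"
  have q0: "q \<noteq> 0" using q by simp
  have N: "q ^ n * q = q ^ s * q ^ f"
  proof -
    have "s + f = Suc n" using n by (simp add: s_def)
    then have "q ^ s * q ^ f = q ^ Suc n" by (metis power_add)
    then show ?thesis by simp
  qed
  have T: "?T = G * (1 - q * q ^ n) * qprod (- \<alpha> * q ^ (k + s)) q f * lprod \<alpha> (\<nu> * q ^ k) q e"
    using n by (simp add: fused_term_def core_term_def G_def qprod_Suc s_def add.assoc)
  have F: "?F = G * (1 - q ^ f) * qprod (- \<alpha> * q ^ (k + s)) q (f - 1) * lprod \<alpha> (\<nu> * q ^ k) q e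
      * (1 + \<alpha> * q ^ n * q ^ (k + l))"
  proof (cases f)
    case (Suc f')
    have "l + d + e + f' = n" using n Suc by simp
    with Suc show ?thesis
      by (simp add: fused_term_def core_term_def G_def s_def qmult_f[OF q, of l d e f'] add.assoc)
  qed simp
  have E: "?E = G * q ^ f * (q / q ^ e * (1 - q ^ e)) * (\<alpha> * q ^ n + \<nu> * q ^ (k + l))
      * qprod (- \<alpha> * q ^ (k + s) / q) q f * lprod \<alpha> (\<nu> * q ^ k) q (e - 1)"
  proof (cases e)
    case (Suc e')
    have n': "l + d + e' + f = n" using n Suc by simp
    then have "q ^ n = q ^ f * q ^ (l + d + e')" by (metis power_add add.commute)
    moreover have "q ^ (l + d + e') * qmult q l d e' f = qmult q l d e f * (1 - q * q ^ e') / q ^ e'"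
      using qmult_e[OF q, of l d e' f] Suc q0 by (simp add: nonzero_eq_divide_eq mult_ac)
    ultimately have "q ^ n * qmult q l d e' f = q ^ f * (qmult q l d e f * (1 - q * q ^ e') / q ^ e')"
      by (simp only: mult.assoc)
    moreover have "?E = (q ^ n * qmult q l d e' f) * (qprod q q n * \<alpha> ^ d * qprod (q ^ Suc k) q d
        * qprod (\<nu> * q ^ k) q l * (\<alpha> * q ^ n + \<nu> * q ^ (k + l))
      * qprod (- \<alpha> * q ^ (k + s) / q) q f * lprod \<alpha> (\<nu> * q ^ k) q (e - 1))"
      using n' Suc q0 by (simp add: fused_term_def core_term_def s_def add.assoc)
    ultimately show ?thesis using Suc q0 by (simp add: G_def)
  qed simp
  have L: "?L = G * q ^ f * (1 - q ^ l)
      * qprod (- \<alpha> * q ^ (k + s) / q) q f * lprod \<alpha> (\<nu> * q ^ k) q e"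
  proof (cases l)
    case (Suc l')
    have n': "l' + d + e + f = n" using n Suc by simp
    then have "q ^ n = q ^ f * q ^ (l' + d + e)" by (metis power_add add.commute)
    then have "q ^ n * qmult q l' d e f = q ^ f * (qmult q l d e f * (1 - q ^ l))"
      using qmult_l[OF q, of l' d e f] Suc by simp
    moreover have "?L = (q ^ n * qmult q l' d e f) * (qprod q q n * \<alpha> ^ d * qprod (q ^ Suc k) q d
        * qprod (\<nu> * q ^ k) q l
      * qprod (- \<alpha> * q ^ (k + s) / q) q f * lprod \<alpha> (\<nu> * q ^ k) q e)"
      using n' Suc q0
      by (simp add: fused_term_def core_term_def s_def add.assoc qprod_Suc power_add mult.assoc)
    ultimately show ?thesis by (simp add: G_def)
  qed simp
  have A: "?A = G * q ^ f * q ^ l * (1 - q ^ d)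
      * qprod (- \<alpha> * q ^ (k + s)) q f * lprod \<alpha> (\<nu> * q ^ k * q) q e"
  proof (cases d)
    case (Suc d')
    have n': "l + d' + e + f = n" using n Suc by simp
    then have "q ^ n = q ^ f * q ^ (l + d' + e)" by (metis power_add add.commute)
    then have "q ^ n * qmult q l d' e f = q ^ f * (qmult q l d e f * (1 - q ^ d))"
      using qmult_d[OF q, of l d' e f] Suc by simp
    \<comment> \<open>The factor \<open>1 - q ^ (k + 1)\<close> of the share completes the product
      over the down steps, and the division by q in the share turns the up product for lowest height
      \<open>k + 1\<close> into the one for \<open>k\<close>.\<close>
    moreover have "?A = (q ^ n * qmult q l d' e f) * (qprod q q n * \<alpha> ^ d * q ^ l * qprod (q ^ Suc k) q d
        * qprod (\<nu> * q ^ k) q l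
      * qprod (- \<alpha> * q ^ (k + s)) q f * lprod \<alpha> (\<nu> * q ^ k * q) q e)"
      using n' Suc q0
      by (simp add: split_a_def core_term_def s_def add.assoc qprod_Suc_shift mult_ac)
    ultimately show ?thesis by (simp add: G_def)
  qed simp
  have B: "?B = G * q ^ n * (q / q ^ e * (1 - q ^ e)) * (1 - q ^ f) * \<alpha> * (1 - \<nu> * (q ^ k * q ^ k) * q ^ l)
      * qprod (- \<alpha> * q ^ (k + s)) q (f - 1) * lprod \<alpha> (\<nu> * q ^ k) q (e - 1)"
  proof (cases "e = 0 \<or> f = 0")
    case False
    then obtain e' f' where S: "e = Suc e'" "f = Suc f'" by (metis not0_implies_Suc)
    have n': "Suc l + d + e' + f' = n" using n S by simp
    have "(1 - q * q ^ l) * qmult q (Suc l) d e' f' = qmult q l d e f * (q / q ^ e * (1 - q ^ e)) * (1 - q ^ f)"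
      using qmult_lef[OF q, of l e' d f'] S q0 by (simp add: field_simps)
    moreover have "?B = ((1 - q * q ^ l) * qmult q (Suc l) d e' f') * (qprod q q n * \<alpha> ^ d * q ^ n * qprod (q ^ Suc k) q d
        * qprod (\<nu> * q ^ k) q l * \<alpha> * (1 - \<nu> * (q ^ k * q ^ k) * q ^ l)
      * qprod (- \<alpha> * q ^ (k + s)) q (f - 1) * lprod \<alpha> (\<nu> * q ^ k) q (e - 1))"
      using n' S q0
      by (simp add: split_b_def core_term_def s_def add.assoc mult_ac)
    ultimately show ?thesis by (simp add: G_def)
  qed auto
  \<comment> \<open>The products of horizontal weights differ between the terms only by a first or a
    last factor; \<open>R\<close> and, for the empty rows, \<open>P\<close> are the parts they
    share.\<close>
  define R where "R = lprod \<alpha> (\<nu> * q ^ k) q (e - 1)"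
  have R1: "lprod \<alpha> (\<nu> * q ^ k) q e = R * (\<alpha> + \<nu> * q ^ k / q ^ e')"
    and R2: "lprod \<alpha> (\<nu> * q ^ k * q) q e = R * (\<alpha> + \<nu> * q ^ k * q)" if "e = Suc e'" for e'
    unfolding R_def that lprod_Suc_shift[OF q0] by (simp_all add: lprod_Suc)
  define P where "P = qprod (- \<alpha> * q ^ (k + s)) q (f - 1)"
  have P1: "qprod (- \<alpha> * q ^ (k + s)) q f = P * (1 + \<alpha> * q ^ n * q ^ k)"
    and P2: "qprod (- \<alpha> * q ^ (k + s) / q) q f = P * (1 + \<alpha> * (q ^ s / q) * q ^ k)"
    if "f = Suc f'" for f'
  proof -
    have sf: "s + f' = n" using n that by (simp add: s_def)
    show "qprod (- \<alpha> * q ^ (k + s)) q f = P * (1 + \<alpha> * q ^ n * q ^ k)"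
      unfolding that qprod_Suc P_def sf[symmetric] by (simp add: power_add mult_ac)
    show "qprod (- \<alpha> * q ^ (k + s) / q) q f = P * (1 + \<alpha> * (q ^ s / q) * q ^ k)"
      unfolding that qprod_Suc_shift P_def using q0 by (simp add: power_add mult_ac)
  qed
  show ?thesis
  \<comment> \<open>For \<open>f = 0\<close> or \<open>e = 0\<close> the truncated
    \<open>f - 1\<close> or \<open>e - 1\<close> does not shorten a product, so these cases need
    their own identities.\<close>
  proof (cases f)
    case f: 0
    show ?thesis
    proof (cases e)
      case 0
      have "?F + ?E + ?L + ?A + ?B = G * (1 - q ^ l * q ^ d)"
        unfolding F E L A B using f 0 by (simp add: algebra_simps)
      also have "q ^ l * q ^ d = q * q ^ n" using N f 0 by (simp add: s_def power_add mult.commute[of "q ^ n"])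
      finally show ?thesis unfolding T using f 0 by simp
    next
      case (Suc e')
      have n': "q ^ n = q ^ l * q ^ d * q ^ e'" using n f Suc by (auto simp flip: power_add)
      have "?F + ?E + ?L + ?A + ?B = G * R *
         (1 / q ^ e' * (1 - q * q ^ e') * (\<alpha> * q ^ n + \<nu> * q ^ k * q ^ l)
    + (1 - q ^ l) * (\<alpha> + \<nu> * q ^ k / q ^ e')
    + q ^ l * (1 - q ^ d) * (\<alpha> + \<nu> * q ^ k * q))"
        unfolding F E L A B unfolding R1[OF Suc] R2[OF Suc] R_def[symmetric] power_add[of q k l] unfolding f Suc
        using q0 by (simp add: distrib_left mult_ac)
      also have "\<dots> = G * R * ((1 - q * q ^ n) * (\<alpha> + \<nu> * q ^ k / q ^ e'))"
        by (subst recursion_identity_f0[of "q ^ e'", OF _ n']) (use q0 in simp_all)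
      finally show ?thesis unfolding T R1[OF Suc] using f by simp
    qed
  next
    case f: (Suc f')
    show ?thesis
    proof (cases e)
      case 0
      have n': "q ^ n = q ^ l * q ^ d * q ^ f'" using n f 0 by (auto simp flip: power_add)
      have s': "q ^ s = q ^ l * q ^ d" using 0 by (simp add: s_def power_add)
      have "?F + ?E + ?L + ?A + ?B = G * P * ((1 - q * q ^ f') * (1 + \<alpha> * q ^ n * q ^ k * q ^ l)
    + q * q ^ f' * (1 - q ^ l) * (1 + \<alpha> * (q ^ l * q ^ d / q) * q ^ k)
    + q * q ^ f' * q ^ l * (1 - q ^ d) * (1 + \<alpha> * q ^ n * q ^ k))"
        unfolding F E L A B unfolding P1[OF f] P2[OF f] P_def[symmetric] power_add[of q k l] s' unfolding f 0
        by (simp add: distrib_left mult_ac)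
      also have "\<dots> = G * P * ((1 - q * q ^ n) * (1 + \<alpha> * q ^ n * q ^ k))"
        by (subst recursion_identity_e0[OF q0 n']) simp
      finally show ?thesis unfolding T P1[OF f] using 0 by simp
    next
      case (Suc e')
      have n': "q ^ n = q * q ^ l * q ^ d * q ^ e' * q ^ f'" using n f Suc by (auto simp flip: power_add power_Suc)
      have s': "q ^ s / q = q ^ l * q ^ d * q ^ e'" using q0 by (simp add: s_def Suc power_add)
      have "?F = G * P * R * ((1 - q * q ^ f') * (1 + \<alpha> * q ^ n * q ^ k * q ^ l) * (\<alpha> + \<nu> * q ^ k / q ^ e'))"
        unfolding F unfolding P_def[symmetric] R1[OF Suc] power_add[of q k l] unfolding f by simp
      moreover have "?E = G * P * R * (q * q ^ f' / q ^ e' * (1 - q * q ^ e') * (\<alpha> * q ^ n + \<nu> * q ^ k * q ^ l)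
          * (1 + \<alpha> * q ^ l * q ^ d * q ^ e' * q ^ k))"
        unfolding E unfolding P2[OF f] R_def[symmetric] power_add[of q k l] s' unfolding f Suc using q0 by (simp add: mult_ac)
      moreover have "?L = G * P * R * (q * q ^ f' * (1 - q ^ l) * (\<alpha> + \<nu> * q ^ k / q ^ e')
          * (1 + \<alpha> * q ^ l * q ^ d * q ^ e' * q ^ k))"
        unfolding L unfolding P2[OF f] R1[OF Suc] s' unfolding f by (simp add: mult_ac)
      moreover have "?A = G * P * R * (q * q ^ f' * q ^ l * (1 - q ^ d) * (\<alpha> + \<nu> * q ^ k * q) * (1 + \<alpha> * q ^ n * q ^ k))"
        unfolding A unfolding P1[OF f] R2[OF Suc] unfolding f by simp
      moreover have "?B = G * P * R * (q ^ n / q ^ e' * (1 - q * q ^ e') * (1 - q * q ^ f') * \<alpha> * (1 - \<nu> * q ^ k * q ^ k * q ^ l))"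
        unfolding B unfolding P_def[symmetric] R_def[symmetric] unfolding f Suc using q0 by (simp add: mult_ac)
      ultimately have "?F + ?E + ?L + ?A + ?B = G * P * R *
     ((1 - q * q ^ f') * (1 + \<alpha> * q ^ n * q ^ k * q ^ l) * (\<alpha> + \<nu> * q ^ k / q ^ e')
    + q * q ^ f' / q ^ e' * (1 - q * q ^ e') * (\<alpha> * q ^ n + \<nu> * q ^ k * q ^ l) * (1 + \<alpha> * q ^ l * q ^ d * q ^ e' * q ^ k)
    + q * q ^ f' * (1 - q ^ l) * (\<alpha> + \<nu> * q ^ k / q ^ e') * (1 + \<alpha> * q ^ l * q ^ d * q ^ e' * q ^ k)
    + q * q ^ f' * q ^ l * (1 - q ^ d) * (\<alpha> + \<nu> * q ^ k * q) * (1 + \<alpha> * q ^ n * q ^ k)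
    + q ^ n / q ^ e' * (1 - q * q ^ e') * (1 - q * q ^ f') * \<alpha> * (1 - \<nu> * q ^ k * q ^ k * q ^ l))"
        by (simp only: distrib_left)
      also have "\<dots> = G * P * R *
          ((1 - q * q ^ n) * (1 + \<alpha> * q ^ n * q ^ k) * (\<alpha> + \<nu> * q ^ k / q ^ e'))"
        by (subst recursion_identity[OF _ n']) (use q0 in simp_all)
      finally show ?thesis unfolding T P1[OF f] R1[OF Suc] by simp
    qed
  qed
qed

text \<open>Extension by zero to integer indices, so that lowering an index needs neither truncated
  subtraction nor a case distinction.\<close>

definition guarded :: "(nat \<Rightarrow> nat \<Rightarrow> nat \<Rightarrow> real) \<Rightarrow> int \<Rightarrow> int \<Rightarrow> int \<Rightarrow> real" where
  "guarded T l e f = (if l \<ge> 0 \<and> e \<ge> 0 \<and> f \<ge> 0 then T (nat l) (nat e) (nat f) else 0)"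

lemma guarded_of_nat [simp]: "guarded T (int l) (int e) (int f) = T l e f"
  by (simp add: guarded_def)

lemma guarded_neg: "l < 0 \<or> e < 0 \<or> f < 0 \<Longrightarrow> guarded T l e f = 0"
  by (auto simp: guarded_def)

abbreviation fused_int where
  "fused_int q \<nu> \<alpha> l d e f k \<equiv> guarded (\<lambda>l e f. fused_term q \<nu> \<alpha> l d e f k) l e f"

abbreviation split_a_int where
  "split_a_int q \<nu> \<alpha> l d e f k \<equiv> guarded (\<lambda>l e f. split_a q \<nu> \<alpha> l d e f k) l e f"

abbreviation split_b_int where
  "split_b_int q \<nu> \<alpha> l d e f k \<equiv> guarded (\<lambda>l e f. split_b q \<nu> \<alpha> l d e f k) l e f"

lemma split_int_add:
  assumes "q \<noteq> 0"
  shows "split_a_int q \<nu> \<alpha> l d e f k + split_b_int q \<nu> \<alpha> l d e f k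
    = (1 - q powi (int k + l)) * fused_int q \<nu> \<alpha> l d e f k"
proof (cases "l \<ge> 0 \<and> e \<ge> 0 \<and> f \<ge> 0")
  case True
  then obtain l' e' f' where "l = int l'" "e = int e'" "f = int f'"
    by (metis zero_le_imp_eq_int)
  moreover have "q powi (int k + int l') = q ^ (k + l')" by (metis of_nat_add power_int_of_nat)
  ultimately show ?thesis using split_a_plus_split_b[OF assms] by simp
qed (auto simp: guarded_def)

lemma fused_int_recursion:
  fixes q :: real
  assumes q: "q > 0" "q \<noteq> 1" and n: "l + int d + e + f = int (Suc n)"
  shows "fused_int q \<nu> \<alpha> l d e f k =
     fused_int q \<nu> \<alpha> l d e (f - 1) k * (1 + \<alpha> * q ^ n * q powi (int k + l))
   + fused_int q \<nu> \<alpha> l d (e - 1) f k * (q ^ n * (\<alpha> * q ^ n + \<nu> * q powi (int k + l)))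
   + fused_int q \<nu> \<alpha> (l - 1) d e f k * (q ^ n * (1 - \<nu> * q powi (int k + l - 1)))
   + (if d = 0 then 0 else \<alpha> * q ^ n * split_a_int q \<nu> \<alpha> l (d - 1) e f (k + 1))
   + \<alpha> * q ^ n * split_b_int q \<nu> \<alpha> (l + 1) d (e - 1) (f - 1) k"
proof (cases "l \<ge> 0 \<and> e \<ge> 0 \<and> f \<ge> 0")
  case True
  then obtain l' e' f' where S: "l = int l'" "e = int e'" "f = int f'"
    by (metis zero_le_imp_eq_int)
  have n': "l' + d + e' + f' = Suc n" using n S by simp
  have P: "q powi (int k + l) = q ^ (k + l')" unfolding S by (metis of_nat_add power_int_of_nat)
  have 1: "fused_int q \<nu> \<alpha> l d e (f - 1) k = (if f' = 0 then 0 else fused_term q \<nu> \<alpha> l' d e' (f' - 1) k)"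
    by (auto simp: S guarded_def nat_diff_distrib)
  have 2: "fused_int q \<nu> \<alpha> l d (e - 1) f k = (if e' = 0 then 0 else fused_term q \<nu> \<alpha> l' d (e' - 1) f' k)"
    by (auto simp: S guarded_def nat_diff_distrib)
  \<comment> \<open>The weight belongs to the equation: at \<open>l' = 0\<close> the truncated
    exponent \<open>k + l' - 1\<close> may differ from the integer one, but both sides
    vanish.\<close>
  have 3: "fused_int q \<nu> \<alpha> (l - 1) d e f k * (q ^ n * (1 - \<nu> * q powi (int k + l - 1)))
     = (if l' = 0 then 0 else fused_term q \<nu> \<alpha> (l' - 1) d e' f' k * (q ^ n * (1 - \<nu> * q ^ (k + l' - 1))))"
  proof (cases l')
    case (Suc l'')
    have "q powi (int k + l - 1) = q ^ (k + l' - 1)"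
      unfolding S Suc by (simp flip: of_nat_add)
    then show ?thesis by (simp add: S guarded_def nat_diff_distrib Suc)
  qed (simp add: S guarded_def)
  have 4: "split_b_int q \<nu> \<alpha> (l + 1) d (e - 1) (f - 1) k
     = (if e' = 0 \<or> f' = 0 then 0 else split_b q \<nu> \<alpha> (l' + 1) d (e' - 1) (f' - 1) k)"
    by (auto simp: S guarded_def nat_diff_distrib nat_add_distrib)
  have 5: "split_a_int q \<nu> \<alpha> l (d - 1) e f (k + 1) = split_a q \<nu> \<alpha> l' (d - 1) e' f' (k + 1)"
    "fused_int q \<nu> \<alpha> l d e f k = fused_term q \<nu> \<alpha> l' d e' f' k"
    by (simp_all only: S guarded_of_nat)
  show ?thesis
    unfolding 1 2 3 4 5 P using fused_term_recursion[OF q n', of \<nu> \<alpha> k] by simp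
next
  case False
  \<comment> \<open>This is the one term with a raised index: for \<open>l = -1\<close> its index is
    0, which is admissible, and it vanishes through the factor \<open>1 - q ^ 0\<close>.\<close>
  then have "split_b_int q \<nu> \<alpha> (l + 1) d (e - 1) (f - 1) k = 0"
    by (auto simp: guarded_def split_b_def)
  moreover have "fused_int q \<nu> \<alpha> l d e f k = 0" "fused_int q \<nu> \<alpha> l d e (f - 1) k = 0"
    "fused_int q \<nu> \<alpha> l d (e - 1) f k = 0" "fused_int q \<nu> \<alpha> (l - 1) d e f k = 0"
    "split_a_int q \<nu> \<alpha> l (d - 1) e f (k + 1) = 0"
    using False by (auto intro!: guarded_neg)
  ultimately show ?thesis by simp
qed

text \<open>The lowest height \<open>k\<close> fixes all row counts: \<open>m - k\<close> up,
  \<open>v - k\<close> down, \<open>h\<close> minus the up rows occupied, and the rest of the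
  \<open>n\<close> rows empty.\<close>

definition fused :: "real \<Rightarrow> real \<Rightarrow> real \<Rightarrow> nat \<Rightarrow> nat \<Rightarrow> int \<Rightarrow> int \<Rightarrow> int \<Rightarrow> real" where
  "fused q \<nu> \<alpha> v n h m h' = (if m + h' = int v + h
     then \<Sum>k\<le>v. fused_int q \<nu> \<alpha> (m - int k) (v - k) (h - m + int k) (int n - int v - h + int k) k
     else 0)"

section \<open>The one-row operator\<close>

text \<open>\<open>\<psi> h m h'\<close> is the weight of having entered \<open>h\<close> paths, left \<open>h'\<close> paths and being at height \<open>m\<close>;
  the row with spectral parameter \<open>\<alpha> * t\<close> is cleared of its denominator \<open>1 + \<alpha> * t\<close> and carries
  the factor \<open>t\<close> of \<open>Lambda\<close> for an entering path. Integer arguments avoid boundary cases, as the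
  weights leading below \<open>0\<close> vanish.\<close>

definition step ::
  "real \<Rightarrow> real \<Rightarrow> real \<Rightarrow> real \<Rightarrow> (int \<Rightarrow> int \<Rightarrow> int \<Rightarrow> real) \<Rightarrow> int \<Rightarrow> int \<Rightarrow> int \<Rightarrow> real" where
  "step q \<nu> \<alpha> t \<psi> h m h' =
     (1 + \<alpha> * t * q powi m) * \<psi> h m h'
   + t * (\<alpha> * t + \<nu> * q powi m) * \<psi> (h - 1) m (h' - 1)
   + \<alpha> * t * (1 - q powi (m + 1)) * \<psi> h (m + 1) (h' - 1)
   + t * (1 - \<nu> * q powi (m - 1)) * \<psi> (h - 1) (m - 1) h'"

definition start :: "nat \<Rightarrow> int \<Rightarrow> int \<Rightarrow> int \<Rightarrow> real" where
  "start v h m h' = (if h = 0 \<and> m = int v \<and> h' = 0 then 1 else 0)"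

lemma fused_0: "fused q \<nu> \<alpha> v 0 = start v"
proof (intro ext)
  fix h m h' :: int
  show "fused q \<nu> \<alpha> v 0 h m h' = start v h m h'"
  proof (cases "m + h' = int v + h")
    case True
    have "fused_int q \<nu> \<alpha> (m - int k) (v - k) (h - m + int k) (int 0 - int v - h + int k) k
        = (if k = v then (if h = 0 \<and> m = int v then 1 else 0) else 0)" if "k \<le> v" for k
    proof (cases "k = v \<and> h = 0 \<and> m = int v")
      case True
      then show ?thesis
        by (simp add: guarded_def fused_term_def core_term_def qmult_def numeral_2_eq_2)
    next
      \<comment> \<open>The four row counts add up to 0 and are not all 0, so one of them is
        negative.\<close>
      case False
      then have "m - int k < 0 \<or> h - m + int k < 0 \<or> int 0 - int v - h + int k < 0"
        using that by linarith
      then show ?thesis using False by (auto simp: guarded_neg)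
    qed
    then show ?thesis using True by (simp add: fused_def start_def sum.delta)
  qed (auto simp: fused_def start_def)
qed

text \<open>The recursion is summed over \<open>k\<close>. Although the two shares of a down step
  enter summands with different lowest heights, they recombine after a shift of the index to the
  full weight \<open>1 - q powi (m + 1)\<close>.\<close>

lemma fused_Suc:
  assumes q: "q > 0" "q \<noteq> 1"
  shows "fused q \<nu> \<alpha> v (Suc n) = step q \<nu> \<alpha> (q ^ n) (fused q \<nu> \<alpha> v n)"
proof (intro ext)
  fix h m h' :: int
  show "fused q \<nu> \<alpha> v (Suc n) h m h' = step q \<nu> \<alpha> (q ^ n) (fused q \<nu> \<alpha> v n) h m h'"
  proof (cases "m + h' = int v + h")
    case True
    define fu where "fu h m k = fused_int q \<nu> \<alpha> (m - int k) (v - k) (h - m + int k) (int n - int v - h + int k) k" for h m k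
    define a where "a k = split_a_int q \<nu> \<alpha> (m + 1 - int k) (v - k) (h - m - 1 + int k) (int n - int v - h + int k) k" for k
    define b where "b k = split_b_int q \<nu> \<alpha> (m + 1 - int k) (v - k) (h - m - 1 + int k) (int n - int v - h + int k) k" for k
    \<comment> \<open>Re-indexing loses nothing: the share at \<open>k = 0\<close> carries the
      factor \<open>1 - q ^ 0\<close>, and at \<open>k = v\<close> there is no down row.\<close>
    have shift: "(\<Sum>k\<le>v. if k = v then 0 else a (Suc k)) = (\<Sum>k\<le>v. a k)"
    proof -
      have "a 0 = 0" by (simp add: a_def guarded_def split_a_def)
      then have "(\<Sum>k\<le>v. a k) = (\<Sum>k<v. a (Suc k))"
        by (simp add: sum.atMost_shift)
      also have "\<dots> = (\<Sum>k<v. if k = v then 0 else a (Suc k))" by (intro sum.cong) auto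
      also have "\<dots> = (\<Sum>k\<le>v. if k = v then 0 else a (Suc k))"
        by (simp add: lessThan_Suc_atMost[symmetric])
      finally show ?thesis by simp
    qed
    have split: "a k + b k = (1 - q powi (m + 1)) * fu h (m + 1) k" for k
    proof -
      have "int k + (m + 1 - int k) = m + 1" "h - m - 1 + int k = h - (m + 1) + int k" by simp_all
      then show ?thesis
        unfolding a_def b_def fu_def using split_int_add[of q] q by (metis less_irrefl)
    qed
    have "fused q \<nu> \<alpha> v (Suc n) h m h' = (\<Sum>k\<le>v.
        fu h m k * (1 + \<alpha> * q ^ n * q powi m)
      + fu (h - 1) m k * (q ^ n * (\<alpha> * q ^ n + \<nu> * q powi m))
      + fu (h - 1) (m - 1) k * (q ^ n * (1 - \<nu> * q powi (m - 1)))
      + \<alpha> * q ^ n * (if k = v then 0 else a (Suc k))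
      + \<alpha> * q ^ n * b k)"
      unfolding fused_def using True
    proof (simp, intro sum.cong refl)
      fix k assume "k \<in> {..v}"
      then have k: "k \<le> v" by simp
      have tot: "(m - int k) + int (v - k) + (h - m + int k) + (1 + int n - int v - h + int k) = int (Suc n)"
        using k by simp
      have e1: "m - (1 + int k) = m - 1 - int k" "h - 1 - (m - 1) + int k = h - m + int k"
        "int n - int v - (h - 1) + int k = 1 + int n - int v - h + int k"
        "h - 1 - m + int k = h - m + int k - 1" "1 + int n - int v - h + int k - 1 = int n - int v - h + int k"
        "m - 1 - int k = m - int k - 1" "int k + (m - int k) = m" "m - int k + 1 = m + 1 - int k"
        by simp_all
      have a': "(if k = v then 0 else a (Suc k)) = (if v - k = 0 then 0
          else split_a_int q \<nu> \<alpha> (m - int k) (v - k - 1) (h - m + int k) (1 + int n - int v - h + int k) (k + 1))"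
        using k by (auto simp: a_def algebra_simps)
      show "fused_int q \<nu> \<alpha> (m - int k) (v - k) (h - m + int k) (1 + int n - int v - h + int k) k =
        fu h m k * (1 + \<alpha> * q ^ n * q powi m)
      + fu (h - 1) m k * (q ^ n * (\<alpha> * q ^ n + \<nu> * q powi m))
      + fu (h - 1) (m - 1) k * (q ^ n * (1 - \<nu> * q powi (m - 1)))
      + \<alpha> * q ^ n * (if k = v then 0 else a (Suc k))
      + \<alpha> * q ^ n * b k"
        unfolding fused_int_recursion[OF q tot] a' unfolding fu_def b_def e1
        by (simp add: algebra_simps)
    qed
    also have "\<dots> = (1 + \<alpha> * q ^ n * q powi m) * (\<Sum>k\<le>v. fu h m k)
      + q ^ n * (\<alpha> * q ^ n + \<nu> * q powi m) * (\<Sum>k\<le>v. fu (h - 1) m k)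
      + q ^ n * (1 - \<nu> * q powi (m - 1)) * (\<Sum>k\<le>v. fu (h - 1) (m - 1) k)
      + \<alpha> * q ^ n * (\<Sum>k\<le>v. if k = v then 0 else a (Suc k))
      + \<alpha> * q ^ n * (\<Sum>k\<le>v. b k)"
      by (simp only: sum.distrib sum_distrib_left) (simp only: mult_ac)
    also have "\<dots> = (1 + \<alpha> * q ^ n * q powi m) * (\<Sum>k\<le>v. fu h m k)
      + q ^ n * (\<alpha> * q ^ n + \<nu> * q powi m) * (\<Sum>k\<le>v. fu (h - 1) m k)
      + \<alpha> * q ^ n * (\<Sum>k\<le>v. a k + b k)
      + q ^ n * (1 - \<nu> * q powi (m - 1)) * (\<Sum>k\<le>v. fu (h - 1) (m - 1) k)"
      unfolding shift by (simp add: sum.distrib algebra_simps)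
    also have "(\<Sum>k\<le>v. a k + b k) = (1 - q powi (m + 1)) * (\<Sum>k\<le>v. fu h (m + 1) k)"
      unfolding split by (simp add: sum_distrib_left)
    finally show ?thesis
      using True unfolding step_def fused_def fu_def[symmetric] by (simp add: mult.assoc)
  qed (auto simp: fused_def step_def)
qed

text \<open>Rows with parameters \<open>s\<close> and \<open>t\<close> commute because \<open>step\<close> is a polynomial in \<open>t\<close> whose
  coefficients are the identity, a single operator and a scaled shift commuting with it.\<close>

definition step_lin ::
  "real \<Rightarrow> real \<Rightarrow> real \<Rightarrow> (int \<Rightarrow> int \<Rightarrow> int \<Rightarrow> real) \<Rightarrow> int \<Rightarrow> int \<Rightarrow> int \<Rightarrow> real" where
  "step_lin q \<nu> \<alpha> \<psi> h m h' =
     \<alpha> * q powi m * \<psi> h m h' + \<nu> * q powi m * \<psi> (h - 1) m (h' - 1)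
   + \<alpha> * (1 - q powi (m + 1)) * \<psi> h (m + 1) (h' - 1)
   + (1 - \<nu> * q powi (m - 1)) * \<psi> (h - 1) (m - 1) h'"

lemma step_decomp:
  "step q \<nu> \<alpha> t \<psi> h m h' = \<psi> h m h' + t * step_lin q \<nu> \<alpha> \<psi> h m h' + t\<^sup>2 * (\<alpha> * \<psi> (h - 1) m (h' - 1))"
  by (simp add: step_def step_lin_def algebra_simps power2_eq_square)

lemma step_commute: "step q \<nu> \<alpha> s (step q \<nu> \<alpha> t \<psi>) = step q \<nu> \<alpha> t (step q \<nu> \<alpha> s \<psi>)"
proof (intro ext)
  fix h m h' :: int
  have lin: "step_lin q \<nu> \<alpha> (step q \<nu> \<alpha> t \<psi>) h m h' = step_lin q \<nu> \<alpha> \<psi> h m h'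
      + t * step_lin q \<nu> \<alpha> (step_lin q \<nu> \<alpha> \<psi>) h m h' + t\<^sup>2 * (\<alpha> * step_lin q \<nu> \<alpha> \<psi> (h - 1) m (h' - 1))" for t
    unfolding step_lin_def[of q \<nu> \<alpha> "step q \<nu> \<alpha> t \<psi>"] step_decomp
    unfolding step_lin_def[of q \<nu> \<alpha> "step_lin q \<nu> \<alpha> \<psi>"] step_lin_def[of q \<nu> \<alpha> \<psi> h m h'] step_lin_def[of q \<nu> \<alpha> \<psi> "h-1" m "h'-1"]
    by (simp add: algebra_simps)
  show "step q \<nu> \<alpha> s (step q \<nu> \<alpha> t \<psi>) h m h' = step q \<nu> \<alpha> t (step q \<nu> \<alpha> s \<psi>) h m h'"
    unfolding step_decomp[of q \<nu> \<alpha> _ "step q \<nu> \<alpha> _ \<psi>"] lin step_decomp[of q \<nu> \<alpha> _ \<psi>]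
    by (simp add: algebra_simps)
qed

lemma fold_step_rev: "fold (step q \<nu> \<alpha>) (rev ts) = fold (step q \<nu> \<alpha>) ts"
  by (rule fold_rev) (auto simp: fun_eq_iff intro: step_commute[THEN fun_cong, THEN fun_cong, THEN fun_cong])

lemma fold_step_eq_fused:
  assumes "q > 0" "q \<noteq> 1"
  shows "fold (step q \<nu> \<alpha>) (map (\<lambda>i. q ^ i) [0..<n]) (start v) = fused q \<nu> \<alpha> v n"
  by (induction n) (simp_all add: fused_0 fused_Suc[OF assms])

section \<open>Column sums as iterated one-row operators\<close>

lemma sum_PiE_insert:
  assumes "x \<notin> S"
  shows "(\<Sum>g\<in>Pi\<^sub>E (insert x S) T. F g) = (\<Sum>g\<in>Pi\<^sub>E S T. \<Sum>y\<in>T x. F (g(x := y)))"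
proof -
  have "(\<Sum>g\<in>Pi\<^sub>E (insert x S) T. F g) = (\<Sum>(y, g)\<in>T x \<times> Pi\<^sub>E S T. F (g(x := y)))"
    unfolding PiE_insert_eq
    by (subst sum.reindex[OF inj_combinator[OF assms]]) (simp add: case_prod_unfold)
  also have "\<dots> = (\<Sum>y\<in>T x. \<Sum>g\<in>Pi\<^sub>E S T. F (g(x := y)))"
    by (simp add: sum.cartesian_product)
  finally show ?thesis by (simp add: sum.swap[of _ _ "T x"])
qed

definition weight :: "real \<Rightarrow> real \<Rightarrow> real \<Rightarrow> real \<Rightarrow> nat \<Rightarrow> nat \<Rightarrow> nat \<Rightarrow> nat \<Rightarrow> real" where
  "weight q \<nu> \<alpha> t m j m' j' = t ^ j * ((1 + \<alpha> * t) * L1 q \<nu> (\<alpha> * t) m j m' j')"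

definition point :: "nat \<Rightarrow> nat \<Rightarrow> nat \<Rightarrow> int \<Rightarrow> int \<Rightarrow> int \<Rightarrow> real" where
  "point a x b h m h' = (if int a = h \<and> int x = m \<and> int b = h' then 1 else 0)"

text \<open>The column sum without denominators and without 1/Z, for arbitrary row parameters. The
  end data are arguments rather than fixed, so that rows can be added by induction.\<close>

definition path_sum ::
  "real \<Rightarrow> real \<Rightarrow> real \<Rightarrow> nat \<Rightarrow> nat \<Rightarrow> (nat \<Rightarrow> real) \<Rightarrow> nat \<Rightarrow> int \<Rightarrow> int \<Rightarrow> int \<Rightarrow> real" where
  "path_sum q \<nu> \<alpha> I v t J h m h' =
     (\<Sum>hs\<in>bits J. \<Sum>hs'\<in>bits J. \<Sum>w\<in>{0..J} \<rightarrow>\<^sub>E {0..I}.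
        if w 0 = v then (\<Prod>i=1..J. weight q \<nu> \<alpha> (t i) (w (i - 1)) (hs i) (w i) (hs' i))
          * point (\<Sum>i=1..J. hs i) (w J) (\<Sum>i=1..J. hs' i) h m h' else 0)"

text \<open>By linearity the one-row operator is determined by its action on a single state. The
  operator knows no bounds on the height; it agrees with the sum over 0 to \<open>I\<close> because
  the weights leaving this range vanish.\<close>

lemma step_point:
  assumes "q > 0" and \<nu>: "\<nu> = q powi (- int I)" and t: "1 + \<alpha> * t \<noteq> 0" and x: "x \<le> I"
  shows "(\<Sum>j\<in>{0,1}. \<Sum>j'\<in>{0,1}. \<Sum>y\<in>{0..I}. weight q \<nu> \<alpha> t x j y j' * point (a + j) y (b + j') h m h')
    = step q \<nu> \<alpha> t (point a x b) h m h'"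
proof -
  have w: "weight q \<nu> \<alpha> t x 0 y 0 = (if y = x then 1 + \<alpha> * t * q ^ x else 0)"
    "weight q \<nu> \<alpha> t x 1 y 1 = (if y = x then t * (\<alpha> * t + \<nu> * q ^ x) else 0)"
    "weight q \<nu> \<alpha> t x 0 y 1 = (if x = y + 1 then \<alpha> * t * (1 - q ^ x) else 0)"
    "weight q \<nu> \<alpha> t x 1 y 0 = (if y = x + 1 then t * (1 - \<nu> * q ^ x) else 0)" for y
    using t by (auto simp: weight_def L1_def)
  have s1: "(\<Sum>y\<in>{0..I}. (if y = x then c else 0) * point a' y b' h m h') = c * point a' x b' h m h'" for c a' b'
  proof -
    have "(\<Sum>y\<in>{0..I}. (if y = x then c else 0) * point a' y b' h m h')
        = (\<Sum>y\<in>{0..I}. if y = x then c * point a' x b' h m h' else 0)"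
      by (intro sum.cong) auto
    then show ?thesis using x by (simp add: sum.delta)
  qed
  have s2: "(\<Sum>y\<in>{0..I}. (if x = y + 1 then \<alpha> * t * (1 - q ^ x) else 0) * point a' y b' h m h')
      = \<alpha> * t * (1 - q powi (m + 1)) * point a' x b' h (m + 1) h'" for a' b'
  proof (cases x)
    \<comment> \<open>On the right only \<open>m = -1\<close> could contribute, and there
      \<open>1 - q powi (m + 1)\<close> is zero.\<close>
    case 0
    then show ?thesis by (auto simp: point_def)
  next
    case (Suc x')
    then have "(\<Sum>y\<in>{0..I}. (if x = y + 1 then \<alpha> * t * (1 - q ^ x) else 0) * point a' y b' h m h')
        = (\<Sum>y\<in>{0..I}. if y = x' then \<alpha> * t * (1 - q ^ x) * point a' x' b' h m h' else 0)"
      by (intro sum.cong) auto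
    also have "\<dots> = \<alpha> * t * (1 - q ^ x) * point a' x' b' h m h'"
      using Suc x by (simp add: sum.delta)
    also have "\<dots> = \<alpha> * t * (1 - q powi (m + 1)) * point a' x b' h (m + 1) h'"
    proof (cases "m + 1 = int x")
      case True
      then have "q powi (m + 1) = q ^ x" by (simp only: power_int_of_nat)
      moreover have "point a' x' b' h m h' = point a' x b' h (m + 1) h'"
        using Suc True by (simp add: point_def)
      ultimately show ?thesis by simp
    qed (use Suc in \<open>auto simp: point_def\<close>)
    finally show ?thesis .
  qed
  have s3: "(\<Sum>y\<in>{0..I}. (if y = x + 1 then t * (1 - \<nu> * q ^ x) else 0) * point a' y b' h m h')
      = t * (1 - \<nu> * q powi (m - 1)) * point a' x b' h (m - 1) h'" for a' b'
  proof -
    have "(\<Sum>y\<in>{0..I}. (if y = x + 1 then t * (1 - \<nu> * q ^ x) else 0) * point a' y b' h m h')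
        = (\<Sum>y\<in>{0..I}. if y = x + 1 then t * (1 - \<nu> * q ^ x) * point a' (x + 1) b' h m h' else 0)"
      by (intro sum.cong) auto
    also have "\<dots> = t * (1 - \<nu> * q ^ x) * point a' (x + 1) b' h m h'"
    \<comment> \<open>At the top height the up weight is \<open>1 - \<nu> * q ^ I = 0\<close>, so
      the missing height \<open>I + 1\<close> costs nothing.\<close>
    proof (cases "x = I")
      case True
      then have "\<nu> * q ^ x = 1" using assms(1) by (simp add: \<nu> power_int_minus)
      then show ?thesis using True by (simp add: sum.delta)
    qed (use x in \<open>simp add: sum.delta\<close>)
    also have "\<dots> = t * (1 - \<nu> * q powi (m - 1)) * point a' x b' h (m - 1) h'"
    proof (cases "m - 1 = int x")
      case True
      then have "q powi (m - 1) = q ^ x" by simp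
      then show ?thesis using True by (auto simp: point_def)
    qed (auto simp: point_def)
    finally show ?thesis .
  qed
  have p: "point (a + 1) x b h m h' = point a x b (h - 1) m h'"
    "point a x (b + 1) h m h' = point a x b h m (h' - 1)" for a b h m h'
    by (auto simp: point_def)
  have sum2: "(\<Sum>j\<in>{0,1}. \<Sum>j'\<in>{0,1}. F j j') = F 0 0 + F 0 1 + (F 1 0 + F 1 1)"
    for F :: "nat \<Rightarrow> nat \<Rightarrow> real" by simp
  show ?thesis
  proof (cases "m = int x")
    case True
    then have "q powi m = q ^ x" by simp
    then show ?thesis
      unfolding step_def sum2 w s1 s2 s3 p add_0_right by (simp add: algebra_simps)
  next
    case False
    then have "point a x b h m h' = 0" for a b h h' using False by (simp add: point_def)
    then show ?thesis
      unfolding step_def sum2 w s1 s2 s3 p add_0_right by (simp add: algebra_simps)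
  qed
qed

lemma path_sum_0:
  assumes "v \<le> I"
  shows "path_sum q \<nu> \<alpha> I v t 0 = start v"
proof (intro ext)
  fix h m h' :: int
  have "{0..0::nat} = insert 0 {}" by auto
  then show "path_sum q \<nu> \<alpha> I v t 0 h m h' = start v h m h'"
    using assms
    by (auto simp: path_sum_def bits_def start_def point_def sum_PiE_insert if_distrib sum.delta' cong: if_cong)
qed

text \<open>The sums over the last row are split off and moved innermost, where
  \<open>step_point\<close> applies to the state reached after \<open>J\<close> rows; linearity of
  \<open>step\<close> then takes the operator out of the remaining sums.\<close>

lemma path_sum_Suc:
  assumes "q > 0" and \<nu>: "\<nu> = q powi (- int I)" and t: "1 + \<alpha> * t (Suc J) \<noteq> 0"
  shows "path_sum q \<nu> \<alpha> I v t (Suc J) = step q \<nu> \<alpha> (t (Suc J)) (path_sum q \<nu> \<alpha> I v t J)"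
proof (intro ext)
  fix h m h' :: int
  define P where "P hs hs' w = (if w 0 = v then \<Prod>i=1..J. weight q \<nu> \<alpha> (t i) (w (i - 1)) (hs i) (w i) (hs' i) else 0)" for hs hs' w
  have bits_Suc: "(\<Sum>hs\<in>bits (Suc J). F hs) = (\<Sum>hs\<in>bits J. \<Sum>j\<in>{0,1}. F (hs(Suc J := j)))" for F :: "_ \<Rightarrow> real"
    unfolding bits_def by (simp add: atLeastAtMostSuc_conv sum_PiE_insert)
  have heights_Suc: "(\<Sum>w\<in>{0..Suc J} \<rightarrow>\<^sub>E {0..I}. F w) = (\<Sum>w\<in>{0..J} \<rightarrow>\<^sub>E {0..I}. \<Sum>y\<in>{0..I}. F (w(Suc J := y)))" for F :: "_ \<Rightarrow> real"
    by (simp add: atLeastAtMostSuc_conv sum_PiE_insert)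
  have "path_sum q \<nu> \<alpha> I v t (Suc J) h m h' =
     (\<Sum>hs\<in>bits J. \<Sum>j\<in>{0,1}. \<Sum>hs'\<in>bits J. \<Sum>j'\<in>{0,1}. \<Sum>w\<in>{0..J} \<rightarrow>\<^sub>E {0..I}. \<Sum>y\<in>{0..I}.
        P hs hs' w * (weight q \<nu> \<alpha> (t (Suc J)) (w J) j y j' * point ((\<Sum>i=1..J. hs i) + j) y ((\<Sum>i=1..J. hs' i) + j') h m h'))"
    unfolding path_sum_def bits_Suc heights_Suc
  proof (intro sum.cong refl)
    fix hs hs' w :: "nat \<Rightarrow> nat" and j j' y :: nat
    have A: "(\<Sum>i=1..Suc J. (f(Suc J := k)) i) = (\<Sum>i=1..J. f i) + k" for f :: "nat \<Rightarrow> nat" and k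
      by (simp add: sum.cl_ivl_Suc)
    have B: "(\<Prod>i=1..Suc J. weight q \<nu> \<alpha> (t i) ((w(Suc J := y)) (i - 1)) ((hs(Suc J := j)) i) ((w(Suc J := y)) i) ((hs'(Suc J := j')) i))
      = (\<Prod>i=1..J. weight q \<nu> \<alpha> (t i) (w (i - 1)) (hs i) (w i) (hs' i)) * weight q \<nu> \<alpha> (t (Suc J)) (w J) j y j'"
    proof -
      have "(\<Prod>i=1..J. weight q \<nu> \<alpha> (t i) ((w(Suc J := y)) (i - 1)) ((hs(Suc J := j)) i) ((w(Suc J := y)) i) ((hs'(Suc J := j')) i))
        = (\<Prod>i=1..J. weight q \<nu> \<alpha> (t i) (w (i - 1)) (hs i) (w i) (hs' i))"
        by (intro prod.cong refl) auto
      then show ?thesis by (simp add: prod.cl_ivl_Suc)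
    qed
    show "(if (w(Suc J := y)) 0 = v
       then (\<Prod>i=1..Suc J. weight q \<nu> \<alpha> (t i) ((w(Suc J := y)) (i - 1)) ((hs(Suc J := j)) i) ((w(Suc J := y)) i) ((hs'(Suc J := j')) i)) *
         point (\<Sum>i=1..Suc J. (hs(Suc J := j)) i) ((w(Suc J := y)) (Suc J)) (\<Sum>i=1..Suc J. (hs'(Suc J := j')) i) h m h' else 0)
      = P hs hs' w * (weight q \<nu> \<alpha> (t (Suc J)) (w J) j y j' * point ((\<Sum>i=1..J. hs i) + j) y ((\<Sum>i=1..J. hs' i) + j') h m h')"
      unfolding A B P_def by simp
  qed
  also have "\<dots> = (\<Sum>hs\<in>bits J. \<Sum>hs'\<in>bits J. \<Sum>w\<in>{0..J} \<rightarrow>\<^sub>E {0..I}. \<Sum>j\<in>{0,1}. \<Sum>j'\<in>{0,1}. \<Sum>y\<in>{0..I}.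
        P hs hs' w * (weight q \<nu> \<alpha> (t (Suc J)) (w J) j y j' * point ((\<Sum>i=1..J. hs i) + j) y ((\<Sum>i=1..J. hs' i) + j') h m h'))"
    by (simp only: sum.swap[of _ "{0..J} \<rightarrow>\<^sub>E {0..I}" "{0,1::nat}"] sum.swap[of _ "bits J" "{0,1::nat}"])
  also have "\<dots> = (\<Sum>hs\<in>bits J. \<Sum>hs'\<in>bits J. \<Sum>w\<in>{0..J} \<rightarrow>\<^sub>E {0..I}.
        P hs hs' w * step q \<nu> \<alpha> (t (Suc J)) (point (\<Sum>i=1..J. hs i) (w J) (\<Sum>i=1..J. hs' i)) h m h')"
  proof (intro sum.cong refl)
    fix hs hs' w :: "nat \<Rightarrow> nat" assume "w \<in> {0..J} \<rightarrow>\<^sub>E {0..I}"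
    then have "w J \<le> I" by auto
    then show "(\<Sum>j\<in>{0,1}. \<Sum>j'\<in>{0,1}. \<Sum>y\<in>{0..I}.
        P hs hs' w * (weight q \<nu> \<alpha> (t (Suc J)) (w J) j y j' * point ((\<Sum>i=1..J. hs i) + j) y ((\<Sum>i=1..J. hs' i) + j') h m h'))
      = P hs hs' w * step q \<nu> \<alpha> (t (Suc J)) (point (\<Sum>i=1..J. hs i) (w J) (\<Sum>i=1..J. hs' i)) h m h'"
      by (subst step_point[symmetric, OF assms(1) \<nu> t]) (simp_all only: sum_distrib_left)
  qed
  also have "\<dots> = step q \<nu> \<alpha> (t (Suc J)) (path_sum q \<nu> \<alpha> I v t J) h m h'"
  proof -
    have "path_sum q \<nu> \<alpha> I v t J = (\<lambda>h m h'. \<Sum>hs\<in>bits J. \<Sum>hs'\<in>bits J. \<Sum>w\<in>{0..J} \<rightarrow>\<^sub>E {0..I}.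
        P hs hs' w * point (\<Sum>i=1..J. hs i) (w J) (\<Sum>i=1..J. hs' i) h m h')"
      unfolding path_sum_def P_def by (intro ext sum.cong refl) simp
    then show ?thesis
      by (simp only: step_def distrib_left sum.distrib sum_distrib_left mult_ac)
  qed
  finally show "path_sum q \<nu> \<alpha> I v t (Suc J) h m h' = step q \<nu> \<alpha> (t (Suc J)) (path_sum q \<nu> \<alpha> I v t J) h m h'" .
qed

lemma path_sum_eq_fold:
  assumes "q > 0" and "\<nu> = q powi (- int I)" and "v \<le> I" and "\<And>i. i \<in> {1..J} \<Longrightarrow> 1 + \<alpha> * t i \<noteq> 0"
  shows "path_sum q \<nu> \<alpha> I v t J = fold (step q \<nu> \<alpha>) (map t [1..<Suc J]) (start v)"
  using assms(4)
proof (induction J)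
  case (Suc J)
  then show ?case using path_sum_Suc[OF assms(1,2), of \<alpha> t J v] by simp
qed (simp add: path_sum_0 assms)

text \<open>Each row absorbs its denominator and its factor of the entry weight. With
  \<open>t\<close> arbitrary, both orders of the spectral parameters are instances; \<open>c\<close>
  stands for 1/Z.\<close>

lemma column_sum_eq_path_sum:
  assumes "v' \<le> I" and t: "\<And>i. i \<in> {1..J} \<Longrightarrow> 1 + \<alpha> * t i \<noteq> 0"
  shows "(\<Prod>i=1..J. 1 + \<alpha> * t i) * (\<Sum>hs\<in>bits J. \<Sum>hs'\<in>bits J.
       (if h = (\<Sum>i=1..J. hs i) then c * (\<Prod>i\<in>{i \<in> {1..J}. hs i = 1}. t i) else 0)
     * (\<Sum>w\<in>vpaths I J v v'. \<Prod>i=1..J. L1 q \<nu> (\<alpha> * t i) (w (i - 1)) (hs i) (w i) (hs' i))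
     * Xi J hs' h') = c * path_sum q \<nu> \<alpha> I v t J (int h) (int v') (int h')"
  unfolding path_sum_def sum_distrib_left[where A = "bits J"]
proof (intro sum.cong refl)
  fix hs hs' assume hs: "hs \<in> bits J" "hs' \<in> bits J"
  have T: "(\<Prod>i\<in>{i \<in> {1..J}. hs i = 1}. t i) = (\<Prod>i=1..J. t i ^ hs i)"
  proof -
    have "hs i = 0 \<or> hs i = 1" if "i \<in> {1..J}" for i
      using hs(1) that by (auto simp: bits_def PiE_iff)
    then have "(\<Prod>i=1..J. t i ^ hs i) = (\<Prod>i=1..J. if hs i = 1 then t i else 1)"
      by (intro prod.cong refl) (metis power_0 power_one_right)
    then show ?thesis by (simp only: prod.inter_filter[OF finite_atLeastAtMost])
  qed
  have V: "(\<Sum>w\<in>vpaths I J v v'. F w) = (\<Sum>w\<in>{0..J} \<rightarrow>\<^sub>E {0..I}. if w 0 = v \<and> w J = v' then F w else 0)" for F :: "_ \<Rightarrow> real"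
    unfolding vpaths_def by (rule sum.inter_filter) (simp add: finite_PiE)
  show "(\<Prod>i=1..J. 1 + \<alpha> * t i) * (
       (if h = (\<Sum>i=1..J. hs i) then c * (\<Prod>i\<in>{i \<in> {1..J}. hs i = 1}. t i) else 0)
     * (\<Sum>w\<in>vpaths I J v v'. \<Prod>i=1..J. L1 q \<nu> (\<alpha> * t i) (w (i - 1)) (hs i) (w i) (hs' i))
     * Xi J hs' h') =
    c * (\<Sum>w\<in>{0..J} \<rightarrow>\<^sub>E {0..I}.
        (if w 0 = v then (\<Prod>i=1..J. weight q \<nu> \<alpha> (t i) (w (i - 1)) (hs i) (w i) (hs' i))
          * point (\<Sum>i=1..J. hs i) (w J) (\<Sum>i=1..J. hs' i) (int h) (int v') (int h') else 0))"
    unfolding T V sum_distrib_left sum_distrib_right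
    by (intro sum.cong refl) (auto simp: weight_def prod.distrib point_def Xi_def simp del: of_nat_sum)
qed

section \<open>The hypergeometric formula\<close>

lemma real_choose_two: "real (n choose 2) = real n * (real n - 1) / 2"
  by (induction n) (simp_all add: choose2_Suc field_simps numeral_2_eq_2)

text \<open>For negative \<open>n\<close> the new factor cancels a denominator of
  \<open>qpoch a q n\<close>; since \<open>inverse 0 = 0\<close>, it has to be nonzero.\<close>

lemma qpoch_add_one:
  assumes "q \<noteq> 0" and "n < 0 \<Longrightarrow> 1 - a * q powi n \<noteq> 0"
  shows "qpoch a q (n + 1) = qpoch a q n * (1 - a * q powi n)"
proof (cases "n \<ge> 0")
  case True
  then show ?thesis
    by (simp add: qpoch_def nat_add_distrib power_int_def)
next
  case False
  then obtain m where m: "n = - int (Suc m)"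
    by (metis not_le negD)
  show ?thesis
  proof (cases m)
    case 0
    then show ?thesis using m assms(2) by (simp add: qpoch_def)
  next
    case (Suc m')
    then have "nat (- n) = Suc (Suc m')" "nat (- (n + 1)) = Suc m'" "n + 1 < 0" using m by auto
    then show ?thesis
      using m assms(2) False Suc by (simp add: qpoch_def prod.cl_ivl_Suc)
  qed
qed

definition phi_summand :: "nat \<Rightarrow> real list \<Rightarrow> real list \<Rightarrow> real \<Rightarrow> real \<Rightarrow> nat \<Rightarrow> real" where
  "phi_summand n as bs q z k = z ^ k * (qpoch (q powi (- int n)) q (int k) / qpoch q q (int k))
     * (\<Prod>a\<leftarrow>as. qpoch a q (int k)) * (\<Prod>b\<leftarrow>bs. qpoch (b * q ^ k) q (int n - int k))"

text \<open>Collects the powers of q: the prefactor of \<open>LJ\<close>, the argument of the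
  series, the reversals of the symbols with bases q^(-v') and q^(-v), the power in \<open>Z\<close>,
  and the one from \<open>lprod_eq_qpoch\<close>. The total is the exponent in
  \<open>qmult\<close>.\<close>

lemma q_exponent_identity:
  fixes l d e k f :: real
  assumes "v = k + d" "v' = k + l" "h = l + e" "h' = d + e"
  shows "((2 * h - h\<^sup>2) / 4 - (2 * h' - h'\<^sup>2) / 4 + (v'\<^sup>2 + v\<^sup>2) / 4 + (v' * (h' - 1) + v * h) / 2)
      + k + (k * (k - 1) / 2 - v' * k) + (k * (k - 1) / 2 - v * k) + h * (h - 1) / 2
      + (e - k) * (e - k - 1) / 2
    = (l + d + e) * (l + d + e - 1) / 2 + e * (e - 1) / 2"
  unfolding assms by (simp add: power2_eq_square field_simps)

section \<open>Evaluation of the q-Pochhammer symbols in the series\<close>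

context
  fixes q :: real
  assumes q: "q > 0" "q \<noteq> 1"
begin

text \<open>Each factor is reversed by 1 - q^(-m) = -q^(-m) (1 - q^m).\<close>

lemma qprod_neg_power:
  assumes "k \<le> n"
  shows "qprod (q powi (- int n)) q k
    = (- 1) ^ k * q powr (real k * (real k - 1) / 2 - real n * real k) * qprod q q n / qprod q q (n - k)"
  using assms
proof (induction k)
  case 0
  then show ?case using qprod_q_nonzero[OF q] q by simp
next
  case (Suc k)
  define r where "r = n - Suc k"
  have r: "n - k = Suc r" using Suc.prems by (simp add: r_def)
  have nk: "real n = real r + real k + 1" using Suc.prems by (simp add: r_def)
  have e: "q powi (- int n) * q ^ k = q powr (real k - real n)"
    using q by (simp add: powr_diff powr_realpow power_int_minus field_simps)
  have "1 - q powr (real k - real n) = - (q powr (real k - real n)) * (1 - q * q ^ r)"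
    using q by (simp add: nk powr_diff powr_add powr_realpow field_simps)
  moreover have "qprod q q (n - k) = qprod q q r * (1 - q * q ^ r)"
    unfolding r qprod_Suc by simp
  moreover have "real (Suc k) * (real (Suc k) - 1) / 2 - real n * real (Suc k)
      = (real k * (real k - 1) / 2 - real n * real k) + (real k - real n)"
    by (simp add: field_simps)
  then have "q powr (real (Suc k) * (real (Suc k) - 1) / 2 - real n * real (Suc k))
      = q powr (real k * (real k - 1) / 2 - real n * real k) * q powr (real k - real n)"
    by (simp only: powr_add)
  ultimately show ?case
    using Suc one_minus_power_nonzero[OF q, of r] qprod_q_nonzero[OF q, of r]
    by (simp add: qprod_Suc e r_def[symmetric])
qed

lemma qprod_neg_power_eq_0:
  assumes "n < k"
  shows "qprod (q powi (- int n)) q k = 0"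
  unfolding qprod_def using assms q by (intro prod_zero) (auto simp: power_int_minus intro!: bexI[of _ n])

lemma qprod_power_Suc: "qprod (q ^ Suc e) q l = qprod q q (e + l) / qprod q q e"
  using qprod_add[of q q e l] qprod_q_nonzero[OF q, of e] by simp

text \<open>The exponents run from \<open>1 + e\<close>, which is at most 0, to
  \<open>e + int l\<close>, or the range reaches 0 in any case, so a factor \<open>1 - q ^ 0\<close>
  occurs. This removes summands with a negative number of occupied or empty rows.\<close>

lemma qpoch_power_eq_0:
  assumes "e < 0" "e + int l \<ge> 0"
  shows "qpoch (q powi (1 + e)) q (int l) = 0"
proof -
  have "q powi (1 + e) * q ^ n = q powi ((1 + e) + int n)" for n
    using power_int_add[of q "1 + e" "int n"] q by simp
  from this[of "nat (- 1 - e)"] have "q powi (1 + e) * q ^ nat (- 1 - e) = 1"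
    using assms by simp
  then have "1 - q powi (1 + e) * q ^ nat (- 1 - e) = 0"
    using assms by simp
  moreover have "nat (- 1 - e) < l" using assms by auto
  ultimately show ?thesis
    unfolding qpoch_int qprod_def by (intro prod_zero) auto
qed

lemma qpoch_ratio:
  "qpoch (q ^ Suc a) q (int b - int a) = qprod q q b / qprod q q a"
proof (cases "a \<le> b")
  case True
  then show ?thesis
    using qprod_power_Suc[of a "b - a"] by (simp add: qpoch_int flip: of_nat_diff)
next
  case False
  have "qpoch (q ^ Suc a) q (- int c) = qprod q q (a - c) / qprod q q a" if "c \<le> a" for c
    using that
  proof (induction c)
    case 0
    then show ?case using qprod_q_nonzero[OF q] by (simp add: qpoch_def)
  next
    case (Suc c)
    define r where "r = a - Suc c"
    have r: "a - c = Suc r" "a = c + Suc r" using Suc.prems by (auto simp: r_def)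
    have "q ^ Suc a * q powi (- int (Suc c)) = q powi (int (Suc a)) * q powi (- int (Suc c))"
      by (simp only: power_int_of_nat)
    also have "\<dots> = q powi (int (Suc a) + (- int (Suc c)))"
      using q by (intro power_int_add[symmetric]) simp
    also have "int (Suc a) + (- int (Suc c)) = int (Suc r)" using r by simp
    finally have e: "q ^ Suc a * q powi (- int (Suc c)) = q * q ^ r"
      by (simp only: power_int_of_nat power_Suc)
    have "- int (Suc c) + 1 = - int c" by simp
    then have "qpoch (q ^ Suc a) q (- int c) = qpoch (q ^ Suc a) q (- int (Suc c)) * (1 - q * q ^ r)"
      using qpoch_add_one[of q "- int (Suc c)" "q ^ Suc a"] q one_minus_power_nonzero[OF q, of r] unfolding e by simp
    moreover have "qprod q q (a - c) = qprod q q (a - Suc c) * (1 - q * q ^ r)"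
      unfolding r(1) r_def[symmetric] by (simp add: qprod_Suc)
    ultimately have "qpoch (q ^ Suc a) q (- int (Suc c)) * (1 - q * q ^ r)
        = qprod q q (a - Suc c) / qprod q q a * (1 - q * q ^ r)"
      using Suc by simp
    then show ?case
      using one_minus_power_nonzero[OF q, of r] by (metis mult_right_cancel)
  qed
  from this[of "a - b"] False show ?thesis by (simp add: of_nat_diff)
qed

text \<open>The factors \<alpha> + \<nu> q^m with m from 1 to k occur in the denominator of the
  first symbol and in the numerator of the second. They cancel together with the powers of \<alpha>
  and \<nu>, leaving q^(1 + ... + k).\<close>

lemma lprod_base:
  assumes "\<alpha> \<noteq> 0" "\<nu> \<noteq> 0" and "\<And>m. m \<in> {1..k} \<Longrightarrow> \<alpha> + \<nu> * q ^ m \<noteq> 0"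
  shows "\<nu> powi (- int k) * \<alpha> ^ k * qpoch (- \<alpha> * inverse \<nu>) q (- int k) * qprod (- q * \<nu> * inverse \<alpha>) q k
    = q powr (real k * (real k + 1) / 2)"
  using assms(3)
proof (induction k)
  case 0
  then show ?case using q by (simp add: qpoch_def)
next
  case (Suc k)
  have nz: "\<alpha> + \<nu> * q ^ Suc k \<noteq> 0" using Suc.prems[of "Suc k"] by simp
  have a: "1 - (- \<alpha> * inverse \<nu>) * q powi (- int (Suc k)) = (\<alpha> + \<nu> * q ^ Suc k) / (\<nu> * q ^ Suc k)"
    using q assms(2) by (simp only: power_int_minus power_int_of_nat) (simp add: field_simps)
  then have nz': "1 - (- \<alpha> * inverse \<nu>) * q powi (- int (Suc k)) \<noteq> 0"
    using nz q assms(2) by simp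
  have "- int (Suc k) + 1 = - int k" by simp
  then have "qpoch (- \<alpha> * inverse \<nu>) q (- int k) = qpoch (- \<alpha> * inverse \<nu>) q (- int (Suc k)) * ((\<alpha> + \<nu> * q ^ Suc k) / (\<nu> * q ^ Suc k))"
    using qpoch_add_one[of q "- int (Suc k)" "- \<alpha> * inverse \<nu>", OF _ nz'] q
    unfolding a \<open>- int (Suc k) + 1 = - int k\<close> by simp
  then have qp: "qpoch (- \<alpha> * inverse \<nu>) q (- int (Suc k)) = qpoch (- \<alpha> * inverse \<nu>) q (- int k) * (\<nu> * q ^ Suc k) / (\<alpha> + \<nu> * q ^ Suc k)"
    using nz q assms(2) by (simp add: field_simps del: power_Suc)
  have pr: "qprod (- q * \<nu> * inverse \<alpha>) q (Suc k) = qprod (- q * \<nu> * inverse \<alpha>) q k * (\<alpha> + \<nu> * q ^ Suc k) / \<alpha>"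
    using assms(1) by (simp add: qprod_Suc field_simps)
  have nu: "\<nu> powi (- int (Suc k)) = \<nu> powi (- int k) / \<nu>"
    using assms(2) by (simp only: power_int_minus power_int_of_nat) (simp add: field_simps)
  have "real (Suc k) * (real (Suc k) + 1) / 2 = real k * (real k + 1) / 2 + real (Suc k)"
    by (simp add: field_simps)
  then have pw: "q powr (real (Suc k) * (real (Suc k) + 1) / 2) = q powr (real k * (real k + 1) / 2) * q ^ Suc k"
    using q by (simp only: powr_add powr_realpow)
  have IH: "\<nu> powi (- int k) * \<alpha> ^ k * qpoch (- \<alpha> * inverse \<nu>) q (- int k) * qprod (- q * \<nu> * inverse \<alpha>) q k
    = q powr (real k * (real k + 1) / 2)" using Suc.prems by (intro Suc.IH) auto
  define W where "W = \<alpha> + \<nu> * q ^ Suc k"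
  show ?case
    unfolding qp pr nu pw IH[symmetric] W_def[symmetric]
    using nz[folded W_def] assms(1,2) by (simp add: field_simps)
qed

text \<open>Raising \<open>e\<close> by one multiplies both sides by q^(e-k) (\<alpha> + \<nu>
  q^(k-e)); \<open>lprod_base\<close> is the start of the induction.\<close>

lemma lprod_eq_qpoch:
  assumes "\<alpha> \<noteq> 0" "\<nu> \<noteq> 0" and nz: "\<And>m. m \<in> {1..k} \<Longrightarrow> \<alpha> + \<nu> * q ^ m \<noteq> 0"
  shows "\<nu> powi (int e - int k) * \<alpha> ^ k * qpoch (- \<alpha> * inverse \<nu>) q (int e - int k) * qprod (- q * \<nu> * inverse \<alpha>) q k
    = q powr ((real e - real k) * (real e - real k - 1) / 2) * lprod \<alpha> (\<nu> * q ^ k) q e"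
proof (induction e)
  case 0
  have "- real k * (- real k - 1) / 2 = real k * (real k + 1) / 2" by (simp add: field_simps)
  then show ?case using lprod_base[OF assms] by simp
next
  case (Suc e)
  define n where "n = int e - int k"
  have n1: "int (Suc e) - int k = n + 1" by (simp add: n_def)
  have en: "q powi n = q ^ e / q ^ k"
    using q by (simp add: n_def power_int_diff)
  have fac: "1 - (- \<alpha> * inverse \<nu>) * q powi n = q ^ e / q ^ k * (\<alpha> + \<nu> * q ^ k / q ^ e) / \<nu>"
    using assms(2) q by (simp add: en field_simps)
  \<comment> \<open>While \<open>e < k\<close> the symbol has negative index and this factor is a
    denominator; it is one of those assumed nonzero.\<close>
  have nz': "1 - (- \<alpha> * inverse \<nu>) * q powi n \<noteq> 0" if "n < 0"
  proof -
    have "k = (k - e) + e" using that by (simp add: n_def)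
    then have "q ^ k / q ^ e = q ^ (k - e)" using q by (metis nonzero_mult_div_cancel_right power_add power_not_zero less_irrefl)
    moreover have "\<alpha> + \<nu> * q ^ (k - e) \<noteq> 0" using that by (intro nz) (auto simp: n_def)
    ultimately have "\<alpha> + \<nu> * q ^ k / q ^ e \<noteq> 0" by (metis times_divide_eq_right)
    then show ?thesis unfolding fac using q assms(2) by simp
  qed
  have qp: "qpoch (- \<alpha> * inverse \<nu>) q (n + 1) = qpoch (- \<alpha> * inverse \<nu>) q n * (q ^ e / q ^ k * (\<alpha> + \<nu> * q ^ k / q ^ e) / \<nu>)"
    using qpoch_add_one[of q n, OF _ nz'] q unfolding fac by simp
  have nu: "\<nu> powi (n + 1) = \<nu> powi n * \<nu>" using assms(2) by (simp add: power_int_add)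
  have "(real (Suc e) - real k) * (real (Suc e) - real k - 1) / 2 = (real e - real k) * (real e - real k - 1) / 2 + (real e - real k)"
    by (simp add: field_simps)
  then have pw: "q powr ((real (Suc e) - real k) * (real (Suc e) - real k - 1) / 2)
     = q powr ((real e - real k) * (real e - real k - 1) / 2) * (q ^ e / q ^ k)"
    using q by (simp only: powr_add powr_diff powr_realpow)
  have "\<nu> powi (n + 1) * \<alpha> ^ k * qpoch (- \<alpha> * inverse \<nu>) q (n + 1) * qprod (- q * \<nu> * inverse \<alpha>) q k
      = (\<nu> powi n * \<alpha> ^ k * qpoch (- \<alpha> * inverse \<nu>) q n * qprod (- q * \<nu> * inverse \<alpha>) q k)
        * (q ^ e / q ^ k * (\<alpha> + \<nu> * q ^ k / q ^ e))"
    unfolding qp nu using assms(2) by simp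
  also have "\<dots> = q powr ((real (Suc e) - real k) * (real (Suc e) - real k - 1) / 2) * lprod \<alpha> (\<nu> * q ^ k) q (Suc e)"
    unfolding n_def Suc.IH pw lprod_Suc by simp
  finally show ?case unfolding n1 .
qed


text \<open>Parametrising by the row counts makes the lengths of nearly all symbols natural numbers,
  so they become quotients of \<open>qprod q q\<close>; \<open>qpoch_ratio\<close> and
  \<open>lprod_eq_qpoch\<close> treat those of either sign.\<close>

lemma LJ_summand:
  fixes \<nu> \<alpha> :: real and l d e f k :: nat
  defines "v \<equiv> k + d" and "v' \<equiv> k + l" and "h \<equiv> l + e" and "h' \<equiv> d + e" and "J \<equiv> l + d + e + f"
  assumes nz: "\<alpha> \<noteq> 0" "\<nu> \<noteq> 0" "\<And>m. m \<in> {1..k} \<Longrightarrow> \<alpha> + \<nu> * q ^ m \<noteq> 0"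
    "qprod (- \<alpha>) q (v' + h') \<noteq> 0"
  shows "Z q J h * qprod (- \<alpha>) q J *
    (q powr ((2 * real h - (real h)\<^sup>2) / 4 - (2 * real h' - (real h')\<^sup>2) / 4
                + ((real v')\<^sup>2 + (real v)\<^sup>2) / 4
                + (real v' * (real h' - 1) + real v * real h) / 2)
        * (\<nu> powi (int h - int v') * \<alpha> powi (int h' - int h + int v')
             * qpoch (- \<alpha> * inverse \<nu>) q (int h' - int v)
           / (qpoch q q (int v') * qpoch (- \<alpha>) q (int v' + int h')
              * qpoch (q powi (int J + 1 - int h)) q (int h - int h')))
        * phi_summand v' [q powi (- int v), - \<alpha> * q ^ J, - q * \<nu> * inverse \<alpha>]
            [\<nu>, q powi (1 + int h' - int v), q powi (int J + 1 - int v' - int h')] q q k)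
    = fused_term q \<nu> \<alpha> l d e f k"
proof -
  have q0: "q \<noteq> 0" using q by simp
  have exps: "int h - int v' = int e - int k" "int h' - int v = int e - int k"
    "int h' - int h + int v' = int (d + k)" "int v' - int k = int l" "int J - int h = int (d + f)"
    "int v' + int h' = int (v' + h')" "int h - int h' = int (l + f) - int (d + f)"
    by (simp_all add: v_def v'_def h_def h'_def J_def)
  have c1: "q powi (1 + int h' - int v) * q ^ k = q ^ Suc e"
  proof -
    have "q powi (1 + int h' - int v) * q ^ k = q powi (1 + int h' - int v + int k)"
      using power_int_add[of q "1 + int h' - int v" "int k"] q0 by simp
    also have "1 + int h' - int v + int k = int (Suc e)" by (simp add: h'_def v_def)
    finally show ?thesis by (simp only: power_int_of_nat)
  qed
  have c2: "q powi (int J + 1 - int v' - int h') * q ^ k = q ^ Suc f"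
  proof -
    have "q powi (int J + 1 - int v' - int h') * q ^ k = q powi (int J + 1 - int v' - int h' + int k)"
      using power_int_add[of q "int J + 1 - int v' - int h'" "int k"] q0 by simp
    also have "int J + 1 - int v' - int h' + int k = int (Suc f)" by (simp add: h'_def v'_def J_def)
    finally show ?thesis by (simp only: power_int_of_nat)
  qed
  have c3: "q powi (int J + 1 - int h) = q ^ Suc (d + f)"
  proof -
    have "int J + 1 - int h = int (Suc (d + f))" by (simp add: h_def J_def)
    then show ?thesis by (simp only: power_int_of_nat)
  qed
  define X where "X = (2 * real h - (real h)\<^sup>2) / 4 - (2 * real h' - (real h')\<^sup>2) / 4
                + ((real v')\<^sup>2 + (real v)\<^sup>2) / 4 + (real v' * (real h' - 1) + real v * real h) / 2"
  define a1 where "a1 = real k * (real k - 1) / 2 - real v' * real k"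
  define a2 where "a2 = real k * (real k - 1) / 2 - real v * real k"
  define a3 where "a3 = (real e - real k) * (real e - real k - 1) / 2"
  define Y where "Y = qpoch (- \<alpha> * inverse \<nu>) q (int e - int k)"
  define Y' where "Y' = qprod (- q * \<nu> * inverse \<alpha>) q k"
  have kv: "k \<le> v'" "k \<le> v" "v' - k = l" "v - k = d" by (simp_all add: v_def v'_def)
  have neg1: "qpoch (q powi (- int v')) q (int k) = (- 1) ^ k * q powr a1 * qprod q q v' / qprod q q l"
    and neg2: "qpoch (q powi (- int v)) q (int k) = (- 1) ^ k * q powr a2 * qprod q q v / qprod q q d"
    unfolding qpoch_int qprod_neg_power[OF kv(1)] qprod_neg_power[OF kv(2)] kv a1_def a2_def by simp_all
  have p1: "qpoch (q ^ Suc e) q (int l) = qprod q q h / qprod q q e"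
    unfolding qpoch_int qprod_power_Suc by (simp add: h_def add.commute)
  have p2: "qpoch (q ^ Suc f) q (int l) = qprod q q (l + f) / qprod q q f"
    unfolding qpoch_int qprod_power_Suc by (simp add: add.commute)
  have p3: "qpoch (q ^ Suc (d + f)) q (int (l + f) - int (d + f)) = qprod q q (l + f) / qprod q q (d + f)"
    by (rule qpoch_ratio)
  have p4: "qprod q q v = qprod q q k * qprod (q ^ Suc k) q d"
    using qprod_add[of q q k d] by (simp add: v_def)
  \<comment> \<open>Both sides are the product of the first \<open>J + k\<close> factors, cut at
    \<open>J\<close> and at \<open>v' + h'\<close>; this cancels the denominator of
    \<open>LJ\<close> and leaves the \<open>f\<close> empty rows.\<close>
  have p5: "qprod (- \<alpha>) q J * qprod (- \<alpha> * q ^ J) q k = qprod (- \<alpha>) q (v' + h') * qprod (- \<alpha> * q ^ (k + l + d + e)) q f"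
  proof -
    have "J + k = (v' + h') + f" "v' + h' = k + l + d + e" by (simp_all add: J_def v'_def h'_def)
    then show ?thesis by (metis qprod_add)
  qed
  have p6: "\<nu> powi (int e - int k) * \<alpha> ^ k * Y * Y' = q powr a3 * lprod \<alpha> (\<nu> * q ^ k) q e"
    unfolding Y_def Y'_def a3_def by (rule lprod_eq_qpoch[OF nz(1-3)])
  have zz: "Z q J h = q powr (real h * (real h - 1) / 2) * (qprod q q J / (qprod q q h * qprod q q (d + f)))"
    unfolding Z_def exps qpoch_int choose_two[symmetric] real_choose_two[symmetric]
    using q by (simp add: powr_realpow)
  have ex: "q powr X * q ^ k * q powr a1 * q powr a2 * q powr (real h * (real h - 1) / 2)
      * q powr a3 = q ^ (((l + d + e) choose 2) + (e choose 2))"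
  proof -
    have "q ^ (((l + d + e) choose 2) + (e choose 2)) = q powr (real ((l + d + e) choose 2) + real (e choose 2))"
      using q by (simp add: powr_realpow flip: of_nat_add)
    also have "real ((l + d + e) choose 2) + real (e choose 2) = X + real k + a1 + a2 + real h * (real h - 1) / 2 + a3"
      unfolding real_choose_two X_def a1_def a2_def a3_def
      by (subst q_exponent_identity[where l = "real l" and d = "real d" and e = "real e"]) (simp_all add: v_def v'_def h_def h'_def)
    finally show ?thesis using q by (simp add: powr_add powr_realpow)
  qed
  have "(- 1 :: real) ^ k * (- 1) ^ k = 1" by (simp flip: power_mult_distrib)
  note nzq = qprod_q_nonzero[OF q]
  have lhs: "Z q J h * qprod (- \<alpha>) q J *
    (q powr X
        * (\<nu> powi (int h - int v') * \<alpha> powi (int h' - int h + int v')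
             * qpoch (- \<alpha> * inverse \<nu>) q (int h' - int v)
           / (qpoch q q (int v') * qpoch (- \<alpha>) q (int v' + int h')
              * qpoch (q powi (int J + 1 - int h)) q (int h - int h')))
        * phi_summand v' [q powi (- int v), - \<alpha> * q ^ J, - q * \<nu> * inverse \<alpha>]
            [\<nu>, q powi (1 + int h' - int v), q powi (int J + 1 - int v' - int h')] q q k)
    = (q powr X * q ^ k * q powr a1 * q powr a2 * q powr (real h * (real h - 1) / 2) * (((- 1) ^ k * (- 1) ^ k) *
      (qprod q q J / (qprod q q l * qprod q q d * qprod q q e * qprod q q f))) * \<alpha> ^ d
      * (qprod q q v / qprod q q k) * (qprod (- \<alpha>) q J * qprod (- \<alpha> * q ^ J) q k / qprod (- \<alpha>) q (v' + h'))
      * qprod (\<nu> * q ^ k) q l * (\<nu> powi (int e - int k) * \<alpha> ^ k * Y * Y'))"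
    unfolding phi_summand_def exps c3 p3 neg1 zz power_int_of_nat
    apply (simp only: list.map prod_list.Cons prod_list.Nil c1 c2 p1 p2 neg2 exps)
    unfolding qpoch_int Y_def[symmetric] Y'_def[symmetric] power_add
    using nzq nz(4) q0 by (simp add: divide_simps)
  show ?thesis
    unfolding X_def[symmetric] lhs ex p5 p6 \<open>(- 1 :: real) ^ k * (- 1) ^ k = 1\<close> p4
    unfolding fused_term_def core_term_def qmult_def J_def[symmetric]
    using nzq nz(4) ex by (simp add: mult.assoc)
qed
end

text \<open>The series runs over \<open>k\<close> up to \<open>v'\<close>, \<open>fused\<close> over
  \<open>k\<close> up to \<open>v\<close>, and both are supported on \<open>k\<close> up to the
  minimum. There the summands agree by \<open>LJ_summand\<close>, or both vanish because a row count
  is negative.\<close>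

lemma LJ_eq_fused:
  fixes q :: real
  assumes q: "q > 0" "q \<noteq> 1" and \<nu>: "\<nu> = q powi (- int I)" and "\<alpha> \<noteq> 0"
    and nz: "\<And>i. i < I + J \<Longrightarrow> 1 + \<alpha> * q ^ i \<noteq> 0"
    and v: "v \<le> I" "v' \<le> I" "h \<le> J" "h' \<le> J"
  shows "Z q J h * qprod (- \<alpha>) q J * LJ q \<nu> J \<alpha> v h v' h' = fused q \<nu> \<alpha> v J (int h) (int v') (int h')"
proof (cases "v + h = v' + h'")
  case False
  then show ?thesis by (auto simp: LJ_def fused_def)
next
  case True
  define C where "C = q powr ((2 * real h - (real h)\<^sup>2) / 4 - (2 * real h' - (real h')\<^sup>2) / 4
                + ((real v')\<^sup>2 + (real v)\<^sup>2) / 4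
                + (real v' * (real h' - 1) + real v * real h) / 2)
        * (\<nu> powi (int h - int v') * \<alpha> powi (int h' - int h + int v')
             * qpoch (- \<alpha> * inverse \<nu>) q (int h' - int v)
           / (qpoch q q (int v') * qpoch (- \<alpha>) q (int v' + int h')
              * qpoch (q powi (int J + 1 - int h)) q (int h - int h')))"
  define s where "s k = phi_summand v' [q powi (- int v), - \<alpha> * q ^ J, - q * \<nu> * inverse \<alpha>]
            [\<nu>, q powi (1 + int h' - int v), q powi (int J + 1 - int v' - int h')] q q k" for k
  define F where "F k = fused_int q \<nu> \<alpha> (int v' - int k) (v - k) (int h - int v' + int k) (int J - int v - int h + int k) k" for k
  have \<nu>0: "\<nu> \<noteq> 0" using q by (simp add: \<nu>)
  have n1: "\<alpha> + \<nu> * q ^ m \<noteq> 0" if "m \<in> {1..I}" for m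
  proof -
    \<comment> \<open>Since \<nu> = q^(-I), these denominators reduce to the assumed nonzero
      \<open>1 + \<alpha> * q ^ i\<close>.\<close>
    have "\<alpha> + \<nu> * q ^ m = (1 + \<alpha> * q ^ (I - m)) * (\<nu> * q ^ m)"
      using that q by (simp add: \<nu> power_int_minus field_simps flip: power_add)
    moreover have "1 + \<alpha> * q ^ (I - m) \<noteq> 0"
    proof (cases "J = 0")
      case False
      then show ?thesis using that by (intro nz) auto
    qed (use nz that in auto)
    ultimately show ?thesis using \<nu>0 q by simp
  qed
  have n2: "qprod (- \<alpha>) q (v' + h') \<noteq> 0"
    using nz v by (auto simp: qprod_def)
  have e: "Z q J h * qprod (- \<alpha>) q J * (C * s k) = F k" if k: "k \<le> v" "k \<le> v'" for k
  proof (cases "int h - int v' + int k \<ge> 0 \<and> int J - int v - int h + int k \<ge> 0")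
    case True': True
    define l d e f where "l = v' - k" and "d = v - k" and "e = nat (int h - int v' + int k)"
      and "f = nat (int J - int v - int h + int k)"
    have eqs: "v = k + d" "v' = k + l" "h = l + e" "h' = d + e" "J = l + d + e + f"
      using k True True' by (auto simp: l_def d_def e_def f_def)
    have "F k = fused_term q \<nu> \<alpha> l d e f k"
      using True' k by (simp add: F_def guarded_def l_def d_def e_def f_def nat_diff_distrib)
    moreover have "Z q J h * qprod (- \<alpha>) q J * (C * s k) = fused_term q \<nu> \<alpha> l d e f k"
    proof -
      have n3: "\<alpha> + \<nu> * q ^ m \<noteq> 0" if "m \<in> {1..k}" for m using that k v by (intro n1) auto
      show ?thesis
        unfolding C_def s_def using LJ_summand[OF q \<open>\<alpha> \<noteq> 0\<close> \<nu>0 n3, of k l d e f] n2 unfolding eqs by blast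
    qed
    ultimately show ?thesis by simp
  next
    case False
    define b where "b = int h - int v' + int k"
    define c where "c = int J - int v - int h + int k"
    have F0: "F k = 0" unfolding F_def using False by (intro guarded_neg) auto
    have lk: "int v' - int k = int (v' - k)" using k by simp
    have pw: "q powi x * q ^ k = q powi (x + int k)" for x
      using power_int_add[of q x "int k"] q by simp
    have b': "1 + int h' - int v + int k = 1 + b" and c': "int J + 1 - int v' - int h' + int k = 1 + c"
      using True by (simp_all add: b_def c_def)
    \<comment> \<open>The would-be numbers \<open>b\<close> of occupied and \<open>c\<close> of
      empty rows are not both nonnegative. Adding \<open>v' - k\<close> to them gives
      \<open>h\<close> and \<open>J - h'\<close>, both nonnegative, so a lower parameter annihilates
      the summand.\<close>
    have "qpoch (q powi (1 + b)) q (int (v' - k)) = 0 \<or> qpoch (q powi (1 + c)) q (int (v' - k)) = 0"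
    proof (cases "b < 0")
      case True
      then show ?thesis using qpoch_power_eq_0[OF q, of b "v' - k"] k by (simp add: b_def)
    next
      case False': False
      then have "c < 0" using False by (auto simp: b_def c_def)
      moreover have "c + int (v' - k) \<ge> 0" using True k v by (simp add: c_def)
      ultimately show ?thesis using qpoch_power_eq_0[OF q, of c "v' - k"] by simp
    qed
    then have "s k = 0"
      unfolding s_def phi_summand_def lk by (auto simp only: list.map prod_list.Cons prod_list.Nil pw b' c' mult_zero_left mult_zero_right)
    then show ?thesis using F0 by simp
  qed
  have s0: "s k = 0" if "k > v" for k
    unfolding s_def phi_summand_def by (simp add: qpoch_int qprod_neg_power_eq_0[OF q that])
  have F0: "F k = 0" if "k > v'" for k
    unfolding F_def using that by (intro guarded_neg) auto
  have "LJ q \<nu> J \<alpha> v h v' h' = C * (\<Sum>k\<in>{0..v'}. s k)"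
    using True unfolding LJ_def C_def phi_bar_def s_def phi_summand_def by simp
  also have "(\<Sum>k\<in>{0..v'}. s k) = (\<Sum>k\<in>{0..min v v'}. s k)"
    by (rule sum.mono_neutral_right) (auto intro: s0)
  finally have "Z q J h * qprod (- \<alpha>) q J * LJ q \<nu> J \<alpha> v h v' h' = (\<Sum>k\<in>{0..min v v'}. F k)"
    by (simp add: sum_distrib_left e)
  also have "\<dots> = (\<Sum>k\<le>v. F k)"
    by (rule sum.mono_neutral_left) (auto intro: F0)
  also have "\<dots> = fused q \<nu> \<alpha> v J (int h) (int v') (int h')"
    using True by (simp add: fused_def F_def)
  finally show ?thesis .
qed

lemma map_power_diff: "map (\<lambda>i. q ^ (J - i)) [1..<Suc J] = rev (map (\<lambda>i. q ^ i) [0..<J])" for q :: real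
  by (rule nth_equalityI) (auto simp: rev_nth nth_append)

lemma map_power_pred: "map (\<lambda>i. q ^ (i - 1)) [1..<Suc J] = map (\<lambda>i. q ^ i) [0..<J]" for q :: real
  by (induction J) simp_all

theorem lemma2p1:
  fixes I J v v' h h' :: nat and q \<nu> \<alpha> :: real
  assumes "I \<ge> 1" and "J \<ge> 1"
    and "q > 0" and "q \<noteq> 1"
    and "\<nu> = q powi (- int I)"
    and "\<alpha> \<noteq> 0"
    and "\<And>i. i < I + J \<Longrightarrow> 1 + \<alpha> * q ^ i \<noteq> 0"
    and "v \<in> {0..I}" and "v' \<in> {0..I}"
    and "h \<in> {0..J}" and "h' \<in> {0..J}"
  shows "(\<Sum>hs\<in>bits J. \<Sum>hs'\<in>bits J.
            Lambda q J h hs * Lcol q \<nu> I J \<alpha> v hs v' hs' * Xi J hs' h')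
       = (\<Sum>hs\<in>bits J. \<Sum>hs'\<in>bits J.
            Lambda_tilde q J h hs * Lcol_tilde q \<nu> I J \<alpha> v hs v' hs' * Xi J hs' h')
     \<and> LJ q \<nu> J \<alpha> v h v' h'
       = (\<Sum>hs\<in>bits J. \<Sum>hs'\<in>bits J.
            Lambda_tilde q J h hs * Lcol_tilde q \<nu> I J \<alpha> v hs v' hs' * Xi J hs' h')"
    (is "?S = ?S' \<and> ?L = ?S'")
proof -
  \<comment> \<open>The row denominators multiply to \<open>P\<close> in either order; all three
    quantities, multiplied by \<open>P\<close>, become \<open>W\<close> divided by
    \<open>Z q J h\<close>.\<close>
  define P where "P = qprod (- \<alpha>) q J"
  define W where "W = fused q \<nu> \<alpha> v J (int h) (int v') (int h')"
  have v: "v \<le> I" "v' \<le> I" "h \<le> J" "h' \<le> J" using assms(8-11) by auto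
  have P: "(\<Prod>i=1..J. 1 + \<alpha> * q ^ (i - 1)) = P"
    unfolding P_def qprod_def
    by (rule prod.reindex_bij_witness[of _ Suc "\<lambda>i. i - 1"]) auto
  have P': "(\<Prod>i=1..J. 1 + \<alpha> * q ^ (J - i)) = P"
    unfolding P_def qprod_def
    by (rule prod.reindex_bij_witness[of _ "\<lambda>i. J - i" "\<lambda>i. J - i"]) auto
  have P0: "P \<noteq> 0" unfolding P_def qprod_def using assms(7) by auto
  have Z0: "Z q J h \<noteq> 0"
    using qprod_q_nonzero[OF assms(3,4)] assms(3) v by (simp add: Z_def qpoch_int flip: of_nat_diff)
  have "P * ?S = 1 / Z q J h * path_sum q \<nu> \<alpha> I v (\<lambda>i. q ^ (i - 1)) J (int h) (int v') (int h')"
    unfolding Lambda_def Lcol_def P[symmetric]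
    by (rule column_sum_eq_path_sum) (use v assms(7) in auto)
  also have "path_sum q \<nu> \<alpha> I v (\<lambda>i. q ^ (i - 1)) J = fused q \<nu> \<alpha> v J"
    unfolding fold_step_eq_fused[OF assms(3,4), symmetric] map_power_pred[symmetric]
    by (rule path_sum_eq_fold) (use v assms(3,5,7) in auto)
  finally have S: "P * ?S = 1 / Z q J h * W" by (simp only: W_def)
  have "P * ?S' = 1 / Z q J h * path_sum q \<nu> \<alpha> I v (\<lambda>i. q ^ (J - i)) J (int h) (int v') (int h')"
    unfolding Lambda_tilde_def Lcol_tilde_def P'[symmetric]
    by (rule column_sum_eq_path_sum) (use v assms(7) in auto)
  also have "path_sum q \<nu> \<alpha> I v (\<lambda>i. q ^ (J - i)) J = fold (step q \<nu> \<alpha>) (map (\<lambda>i. q ^ (J - i)) [1..<Suc J]) (start v)"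
    by (rule path_sum_eq_fold) (use v assms(3,5,7) in auto)
  \<comment> \<open>The decreasing order of parameters is the reversed list, and commutation of the
    rows makes the order immaterial.\<close>
  also have "\<dots> = fused q \<nu> \<alpha> v J"
    unfolding map_power_diff fold_step_rev by (rule fold_step_eq_fused[OF assms(3,4)])
  finally have S': "P * ?S' = 1 / Z q J h * W" by (simp only: W_def)
  have W: "Z q J h * P * ?L = W"
    unfolding P_def W_def by (rule LJ_eq_fused[OF assms(3-7) v])
  have L: "P * ?L = 1 / Z q J h * W"
    unfolding W[symmetric] using Z0 by simp
  have "?S = ?S'"
    by (rule mult_left_cancel[OF P0, THEN iffD1]) (simp only: S S')
  moreover have "?L = ?S'"
    by (rule mult_left_cancel[OF P0, THEN iffD1]) (simp only: L S')
  ultimately show ?thesis by blast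
qed

end
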